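(* Let $k$ be any natural number. Then: (1) $[\mathfrak{C}_T]^1_k=\mathrm{dec}^{k}_{\mathrm d}[\Pi^0_1]$. (2) $[\mathfrak{C}_T]^1_{\omega|k}=\mathrm{dec}^{k}_{x}[\Delta^0_2]=\mathrm{dec}^{k}_{\mathrm c}[\Sigma^0_2]$ for any $x\in\{\mathrm p,\mathrm c,\mathrm d\}$. (3) $[\mathfrak{C}_T]^1_{\omega}=\mathrm{dec}^{\omega}_{x}[\Pi^0_1]=\mathrm{dec}^{\omega}_{x}[\Delta^0_2]=\mathrm{dec}^{\omega}_{\mathrm c}[\Sigma^0_2]$ for any $x\in\{\mathrm p,\mathrm c,\mathrm d\}$. (4) $[\mathfrak{C}_T]^{k}_{1}=\mathrm{dec}^{k}_{x}[-]$ for any $x\in\{\mathrm p,\mathrm c,\mathrm d\}$. (5) $[\mathfrak{C}_T]^{k}_{\omega}=\mathrm{dec}^{k}_y\mathrm{dec}^{\omega}_{x}[\Pi^0_1]=\mathrm{dec}^{k}_y\mathrm{dec}^{\omega}_{x}[\Delta^0_2]=\mathrm{dec}^{k}_y\mathrm{dec}^{\omega}_{\mathrm c}[\Sigma^0_2]$ for any $x,y\in\{\mathrm p,\mathrm c,\mathrm d\}$. (6) $[\mathfrak{C}_T]^{\omega}_{1}=\mathrm{dec}^{\omega}_{x}[-]$ for any $x\in\{\mathrm p,\mathrm c,\mathrm d\}$.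
   Context: $\{\Phi_e\}$ enumerates all partial computable functions $\subseteq\mathbb{N}^\mathbb{N}\to\mathbb{N}^\mathbb{N}$; $\{\Psi_e\}$ is a fixed effective enumeration of total computable learners $\mathbb{N}^{<\mathbb{N}}\to\mathbb{N}$ dominating every partial computable $\Psi:\subseteq\mathbb{N}^{<\mathbb{N}}\to\mathbb{N}$ (whenever $\lim_s\Psi(f\upharpoonright s)$ converges, $\lim_s\Psi_e(f\upharpoonright s)$ converges to the same value). $\mathtt{mcl}_\Psi(g)=\{n:\Psi(g\upharpoonright n+1)\ne\Psi(g\upharpoonright n)\}$, $\mathtt{indx}_\Psi(g)=\{\Psi(g\upharpoonright n):n\}$. For ordinals $\alpha,\beta,\gamma\le\omega$, $[\mathfrak{C}_T]^\alpha_{\beta|\gamma}$ is the class of partial $\Gamma:\subseteq\mathbb{N}^\mathbb{N}\to\mathbb{N}^\mathbb{N}$ for which there is $I\subseteq\mathbb{N}$ of cardinality $\alpha$ such that for every $g\in\mathrm{dom}(\Gamma)$ some $e\in I$ has $\lim_n\Psi_e(g\upharpoonright n)$ convergent, $\Phi_{\lim_n\Psi_e(g\upharpoonright n)}(g)=\Gamma(g)$, $\#\mathtt{mcl}_{\Psi_e}(g)<\beta$, $\#\mathtt{indx}_{\Psi_e}(g)\le\gamma$; $[\mathfrak{C}_T]^\alpha_\beta=[\mathfrak{C}_T]^\alpha_{\beta|\omega}$. Let $\Lambda$ be one of the lightface classes $\Pi^0_1,\Delta^0_2,\Sigma^0_2$ of subsets of $\mathbb{N}^\mathbb{N}$ (identifying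 $\mathbb{N}\times\mathbb{N}^\mathbb{N}$ with $\mathbb{N}^\mathbb{N}$), or the class of all subsets (written $-$). A family $\{Q^*_i\}_{i\in I}$ is uniformly $\Lambda$ if $\{(i,f):i\in I, f\in Q^*_i\}\in\Lambda$. For $Q\subseteq\mathbb{N}^\mathbb{N}$, $\{Q_i\}_{i\in I}$ is a uniform $\Lambda$ cover of $Q$ if there is a uniformly $\Lambda$ family $\{Q^*_i\}$ with $Q_i=Q\cap Q^*_i$ and $\bigcup_iQ_i=Q$; a uniform $\Lambda$ partition if in addition the $Q_i$ are pairwise disjoint; a uniform $\Lambda$ $d$-layer of $Q$ if there is a uniformly $\Lambda$ family $\{Q^*_i\}_{i\in I}$ ($I$ an initial segment of $\mathbb{N}$) with $Q^*_i\subseteq Q^*_{i+1}$, $Q\subseteq\bigcup_iQ^*_i$ and $Q_i=Q\cap(Q^*_i\setminus Q^*_{i-1})$, $Q^*_{-1}=\emptyset$. For $X\in\mathbb{N}\cup\{\omega\}$ (with $I=X$, identifying $k$ with $\{0,\dots,k-1\}$ and $\omega$ with $\mathbb{N}$) and $x\in\{\mathrm p,\mathrm c,\mathrm d\}$, $\mathrm{dec}^X_x[\Lambda]$ is the class of partial $\Gamma$ such that there is a uniform $\Lambda$ partition ($x=\mathrm p$), cover ($x=\mathrm c$) or $d$-layer ($x=\mathrm d$) $\{Q_i\}_{i\in I}$ of $\mathrm{dom}(\Gamma)$ and a computable $i\mapsto e(i)$ with $\Gamma(g)=\Phi_{e(i)}(g)$ for all $i\in I$, $g\in Q_i$. For a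 class $\mathcal{F}$ and finite $k$, $\mathrm{dec}^k_y\mathcal{F}$ is the class of partial $\Gamma$ admitting a partition ($y=\mathrm p$), cover ($y=\mathrm c$) or $d$-layer ($y=\mathrm d$) $\{Q_i\}_{i<k}$ of $\mathrm{dom}(\Gamma)$ (with no definability requirement) such that $\Gamma\upharpoonright Q_i\in\mathcal{F}$ for each $i<k$; $\mathrm{dec}^k_y\mathrm{dec}^\omega_x[\Lambda]$ is this with $\mathcal{F}=\mathrm{dec}^\omega_x[\Lambda]$.
   Formalization: In (2) equality with dec^k_x[Δ^0_2] fails for k≥2 (Σ^0_2 lacks separation); proved instead: dec^k_x[Δ^0_2]⊆[C_T]^1_{ω|k}, and equality with Δ^0_2 read relative to dom(Γ) (pieces both Σ^0_2 and Π^0_2 in it). {Ψ_e} is a concrete enumeration whose index includes the initial guess. *)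

theory Defs
  imports Complex_Main "HOL-Library.Nat_Bijection" "HOL-Library.Extended_Nat"
    "HOL-Library.Disjoint_Sets" "HOL-Library.Monad_Syntax"
begin

type_synonym baire = "nat \<Rightarrow> nat"

text \<open>Kleene's schemes for partial computable functions relative to an oracle \<open>g\<close>, with numerical
  indices; tuples are coded by \<^const>\<open>prod_encode\<close> and strings by \<^const>\<open>list_encode\<close>.\<close>

datatype scheme =
  Ident | Zero | Succ | Fst | Snd | Oracle | Tuple nat nat | Comp nat nat | Rec nat nat | Mu nat | Interp

definition scheme_of :: "nat \<Rightarrow> scheme" where
  "scheme_of e = (let (t, d) = prod_decode e; (a, b) = prod_decode d in
     if t = 0 then Zero else if t = 1 then Succ else if t = 2 then Fst else if t = 3 then Snd
     else if t = 4 then Oracle else if t = 5 then Tuple a b else if t = 6 then Comp a b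
     else if t = 7 then Rec a b else if t = 8 then Mu d else if t = 9 then Interp else Ident)"

text \<open>\<open>run s g e x\<close> is the result of the program with index \<open>e\<close> and oracle \<open>g\<close> on input \<open>x\<close> if it
  halts with recursion depth less than \<open>s\<close>.  \<open>Mu a\<close> maps \<open>(y, n)\<close> to the least zero of \<open>a\<close> on
  \<open>(y, n), (y, n + 1), \<dots>\<close>.  \<open>Interp\<close> is Kleene's scheme S9 \<open>(i, n) \<mapsto> {i}(n)\<close>; it does not enlarge
  the class of computable functions, but it makes the universal function immediate.\<close>

fun run :: "nat \<Rightarrow> baire \<Rightarrow> nat \<Rightarrow> nat \<Rightarrow> nat option" where
  "run 0 g e x = None"
| "run (Suc s) g e x = (let (y, n) = prod_decode x in
     case scheme_of e of
       Ident \<Rightarrow> Some x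
     | Zero \<Rightarrow> Some 0
     | Succ \<Rightarrow> Some (Suc x)
     | Fst \<Rightarrow> Some y
     | Snd \<Rightarrow> Some n
     | Oracle \<Rightarrow> Some (g x)
     | Tuple a b \<Rightarrow> do { u \<leftarrow> run s g a x; v \<leftarrow> run s g b x; Some (prod_encode (u, v)) }
     | Comp a b \<Rightarrow> do { u \<leftarrow> run s g b x; run s g a u }
     | Rec a b \<Rightarrow>
         (case n of
            0 \<Rightarrow> run s g a y
          | Suc m \<Rightarrow> do { r \<leftarrow> run s g e (prod_encode (y, m));
                         run s g b (prod_encode (r, prod_encode (y, m))) })
     | Mu a \<Rightarrow> do { v \<leftarrow> run s g a x;
                    if v = 0 then Some n else run s g e (prod_encode (y, Suc n)) }
     | Interp \<Rightarrow> run s g y n)"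

definition computes :: "baire \<Rightarrow> nat \<Rightarrow> nat \<Rightarrow> nat \<Rightarrow> bool" where
  "computes g e x y \<longleftrightarrow> (\<exists>s. run s g e x = Some y)"

definition computable :: "(nat \<Rightarrow> nat) \<Rightarrow> bool" where
  "computable f \<longleftrightarrow> (\<exists>e. \<forall>x. computes (\<lambda>_. 0) e x (f x))"

definition Phi :: "nat \<Rightarrow> (baire \<rightharpoonup> baire)" where
  "Phi e g = (if \<forall>n. \<exists>y. computes g e n y then Some (\<lambda>n. THE y. computes g e n y) else None)"

definition pre :: "baire \<Rightarrow> nat \<Rightarrow> nat list" where
  "pre f n = map f [0..<n]"

text \<open>The enumeration of total learners: \<open>learner (prod_encode (c, p))\<close> answers, on \<open>\<sigma>\<close>, with the
  value of the partial learner \<open>p\<close> at the longest prefix of \<open>\<sigma>\<close> where that value is found within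
  \<open>length \<sigma>\<close> steps, and with \<open>c\<close> if there is no such prefix.  The parameter \<open>c\<close> avoids a spurious
  first mind change: with a fixed default value, not even the constant learners would occur.\<close>

definition learner :: "nat \<Rightarrow> nat list \<Rightarrow> nat" where
  "learner e \<sigma> = (let (c, p) = prod_decode e;
       v = (\<lambda>n. run (length \<sigma>) (\<lambda>_. 0) p (list_encode (take n \<sigma>)));
       H = {n. n \<le> length \<sigma> \<and> v n \<noteq> None}
     in if H = {} then c else the (v (Max H)))"

definition mcl :: "(nat list \<Rightarrow> nat) \<Rightarrow> baire \<Rightarrow> nat set" where
  "mcl \<Psi> g = {n. \<Psi> (pre g (n + 1)) \<noteq> \<Psi> (pre g n)}"

definition indx :: "(nat list \<Rightarrow> nat) \<Rightarrow> baire \<Rightarrow> nat set" where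
  "indx \<Psi> g = {\<Psi> (pre g n) |n. True}"

definition ecard :: "'a set \<Rightarrow> enat" where
  "ecard A = (if finite A then enat (card A) else \<infinity>)"

text \<open>\<open>CT \<alpha> \<beta> \<gamma>\<close> is the class written with superscript \<open>\<alpha>\<close> and subscript \<open>\<beta>|\<gamma>\<close>;
  the ordinal \<open>\<omega>\<close> is \<open>\<infinity> :: enat\<close>.\<close>

definition CT :: "enat \<Rightarrow> enat \<Rightarrow> enat \<Rightarrow> (baire \<rightharpoonup> baire) set" where
  "CT \<alpha> \<beta> \<gamma> = {\<Gamma>. \<exists>I :: nat set. ecard I = \<alpha> \<and>
     (\<forall>g \<in> dom \<Gamma>. \<exists>e \<in> I.
        (\<exists>p. (\<lambda>n. learner e (pre g n)) \<longlonglongrightarrow> p \<and> Phi p g = \<Gamma> g) \<and>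
        ecard (mcl (learner e) g) < \<beta> \<and> ecard (indx (learner e) g) \<le> \<gamma>)}"

definition Pi01 :: "baire set set" where
  "Pi01 = {{f. \<forall>n. R (pre f n)} |R. computable (\<lambda>u. of_bool (R (list_decode u)))}"

definition Sigma02 :: "baire set set" where
  "Sigma02 = {{f. \<exists>m. \<forall>n. R m (pre f n)} |R.
     computable (\<lambda>x. case prod_decode x of (m, u) \<Rightarrow> of_bool (R m (list_decode u)))}"

definition Pi02 :: "baire set set" where
  "Pi02 = {P. - P \<in> Sigma02}"

definition Delta02 :: "baire set set" where
  "Delta02 = Sigma02 \<inter> Pi02"

text \<open>A pair \<open>(i, f)\<close> is identified with \<open>case_nat i f\<close>, that is, with \<open>i, f 0, f 1, \<dots>\<close>.\<close>

definition uniformly :: "baire set set \<Rightarrow> nat set \<Rightarrow> (nat \<Rightarrow> baire set) \<Rightarrow> bool" where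
  "uniformly \<Lambda> I S \<longleftrightarrow> {case_nat i f |i f. i \<in> I \<and> f \<in> S i} \<in> \<Lambda>"

definition uniform_cover ::
    "baire set set \<Rightarrow> nat set \<Rightarrow> baire set \<Rightarrow> (nat \<Rightarrow> baire set) \<Rightarrow> bool" where
  "uniform_cover \<Lambda> I Q R \<longleftrightarrow>
     (\<exists>S. uniformly \<Lambda> I S \<and> (\<forall>i \<in> I. R i = Q \<inter> S i)) \<and> (\<Union>i \<in> I. R i) = Q"

definition uniform_partition ::
    "baire set set \<Rightarrow> nat set \<Rightarrow> baire set \<Rightarrow> (nat \<Rightarrow> baire set) \<Rightarrow> bool" where
  "uniform_partition \<Lambda> I Q R \<longleftrightarrow> uniform_cover \<Lambda> I Q R \<and> disjoint_family_on R I"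

definition uniform_layer ::
    "baire set set \<Rightarrow> nat set \<Rightarrow> baire set \<Rightarrow> (nat \<Rightarrow> baire set) \<Rightarrow> bool" where
  "uniform_layer \<Lambda> I Q R \<longleftrightarrow>
     (\<exists>S. uniformly \<Lambda> I S \<and> (\<forall>i. Suc i \<in> I \<longrightarrow> S i \<subseteq> S (Suc i)) \<and> Q \<subseteq> (\<Union>i \<in> I. S i) \<and>
          (\<forall>i \<in> I. R i = Q \<inter> (S i - (case i of 0 \<Rightarrow> {} | Suc j \<Rightarrow> S j))))"

datatype shape = Partition | Cover | Layer

fun decomposition ::
    "shape \<Rightarrow> baire set set \<Rightarrow> nat set \<Rightarrow> baire set \<Rightarrow> (nat \<Rightarrow> baire set) \<Rightarrow> bool" where
  "decomposition Partition = uniform_partition"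
| "decomposition Cover = uniform_cover"
| "decomposition Layer = uniform_layer"

definition segment :: "enat \<Rightarrow> nat set" where
  "segment X = {i. enat i < X}"

definition piecewise ::
    "nat set \<Rightarrow> (nat \<Rightarrow> baire set) \<Rightarrow> (baire \<rightharpoonup> baire) \<Rightarrow> bool" where
  "piecewise I R \<Gamma> \<longleftrightarrow> (\<exists>e. computable e \<and> (\<forall>i \<in> I. \<forall>g \<in> R i. \<Gamma> g = Phi (e i) g))"

definition dec :: "shape \<Rightarrow> enat \<Rightarrow> baire set set \<Rightarrow> (baire \<rightharpoonup> baire) set" where
  "dec x X \<Lambda> = {\<Gamma>. \<exists>R. decomposition x \<Lambda> (segment X) (dom \<Gamma>) R \<and> piecewise (segment X) R \<Gamma>}"

text \<open>Decompositions that are \<open>\<Delta>\<^sup>0\<^sub>2\<close> relative to the domain: the pieces are cut out of it by a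
  uniformly \<open>\<Sigma>\<^sup>0\<^sub>2\<close> family and also by a uniformly \<open>\<Pi>\<^sup>0\<^sub>2\<close> family.  Every member of
  \<open>dec x X Delta02\<close> has such a decomposition, but for finite \<open>X \<ge> 2\<close> the converse fails: disjoint
  \<open>\<Sigma>\<^sup>0\<^sub>2\<close> sets \<open>A, B\<close> need not be separated by a \<open>\<Delta>\<^sup>0\<^sub>2\<close> set, and then the function on \<open>A \<union> B\<close>
  that is constantly 0 on \<open>A\<close> and constantly 1 on \<open>B\<close> is in \<open>CT 1 \<infinity> 2\<close>, but not in
  \<open>dec x X Delta02\<close>.\<close>

definition dec_relDelta02 :: "shape \<Rightarrow> enat \<Rightarrow> (baire \<rightharpoonup> baire) set" where
  "dec_relDelta02 x X = {\<Gamma>. \<exists>R. decomposition x Sigma02 (segment X) (dom \<Gamma>) R \<and>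
     decomposition x Pi02 (segment X) (dom \<Gamma>) R \<and> piecewise (segment X) R \<Gamma>}"

definition dec_class ::
    "shape \<Rightarrow> nat \<Rightarrow> (baire \<rightharpoonup> baire) set \<Rightarrow> (baire \<rightharpoonup> baire) set" where
  "dec_class y k F =
     {\<Gamma>. \<exists>R. decomposition y UNIV {..<k} (dom \<Gamma>) R \<and> (\<forall>i<k. \<Gamma> |` R i \<in> F)}"

lemma run_Suc: "run s g e x = Some y \<Longrightarrow> run (Suc s) g e x = Some y"
proof (induction s arbitrary: e x y)
  case (Suc s)
  show ?case
    using Suc.prems
    by (subst run.simps(2), subst (asm) run.simps(2))
      (auto simp: Let_def split: prod.splits scheme.splits nat.splits if_splits Option.bind_splits
        dest!: Suc.IH simp del: run.simps)
qed simp

lemma run_mono: "run s g e x = Some y \<Longrightarrow> s \<le> t \<Longrightarrow> run t g e x = Some y"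
proof (induction t)
  case (Suc t)
  then show ?case by (cases "s = Suc t") (auto intro: run_Suc simp del: run.simps)
qed simp

lemma computes_fun: "computes g e x y \<Longrightarrow> computes g e x z \<Longrightarrow> y = z"
  unfolding computes_def by (metis nle_le option.inject run_mono)

text \<open>The learners dominate the partial computable ones, and the total computable ones without
  additional mind changes or additional values.\<close>

lemma learner_cases:
  obtains (default) "learner (prod_encode (c, p)) (pre f n) = c"
    "\<And>m. m \<le> n \<Longrightarrow> run n (\<lambda>_. 0) p (list_encode (pre f m)) = None"
  | (found) m where "m \<le> n"
    "run n (\<lambda>_. 0) p (list_encode (pre f m)) = Some (learner (prod_encode (c, p)) (pre f n))"
    "\<And>i. i \<le> n \<Longrightarrow> run n (\<lambda>_. 0) p (list_encode (pre f i)) \<noteq> None \<Longrightarrow> i \<le> m"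
proof -
  define v where "v m = run n (\<lambda>_. 0) p (list_encode (pre f m))" for m
  define H where "H = {m. m \<le> n \<and> v m \<noteq> None}"
  have len: "length (pre f n) = n" and tk: "m \<le> n \<Longrightarrow> take m (pre f n) = pre f m" for m
    by (auto simp: pre_def take_map)
  have H: "{m. m \<le> length (pre f n) \<and>
      run (length (pre f n)) (\<lambda>_. 0) p (list_encode (take m (pre f n))) \<noteq> None} = H"
    using tk by (auto simp: H_def v_def len)
  have fin: "finite H" by (simp add: H_def)
  have L: "learner (prod_encode (c, p)) (pre f n) = (if H = {} then c else the (v (Max H)))"
  proof (cases "H = {}")
    case True
    then show ?thesis by (simp only: learner_def H prod_encode_inverse Let_def prod.case if_True refl)
  next
    case False
    then have "Max H \<in> H" using fin by simp
    then have "Max H \<le> n" by (simp add: H_def)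
    then show ?thesis using False by (simp only: learner_def H prod_encode_inverse Let_def prod.case)
        (simp add: len tk v_def)
  qed
  show thesis
  proof (cases "H = {}")
    case True
    then show thesis using L by (intro default) (auto simp: H_def v_def)
  next
    case False
    then have "Max H \<in> H" using fin by simp
    then show thesis using L False Max_ge[OF fin]
      by (intro found[of "Max H"]) (auto simp: H_def v_def)
  qed
qed

lemma learner_dominates_partial:
  assumes "\<And>n. n \<ge> n0 \<Longrightarrow> computes (\<lambda>_. 0) p (list_encode (pre f n)) l"
  shows "(\<lambda>n. learner (prod_encode (c, p)) (pre f n)) \<longlonglongrightarrow> l"
proof -
  obtain s where s: "run s (\<lambda>_. 0) p (list_encode (pre f n0)) = Some l"
    using assms[of n0] by (auto simp: computes_def)
  have "learner (prod_encode (c, p)) (pre f n) = l" if n: "n \<ge> max s n0" for n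
  proof -
    have r: "run n (\<lambda>_. 0) p (list_encode (pre f n0)) = Some l"
      using run_mono[OF s] n by simp
    show ?thesis
    proof (cases rule: learner_cases[of c p f n])
      case default
      then show ?thesis using r n by (metis max.bounded_iff option.distinct(1))
    next
      case (found m)
      have "n0 \<le> m" using found(3)[of n0] r n by simp
      then show ?thesis using found(2) assms[of m] computes_fun by (metis computes_def)
    qed
  qed
  then show ?thesis
    by (intro tendsto_eventually) (auto simp: eventually_sequentially simp del: max.bounded_iff)
qed

lemma learner_dominates_total:
  assumes total: "\<And>\<sigma>. computes (\<lambda>_. 0) p (list_encode \<sigma>) (\<Psi> \<sigma>)"
  defines "e \<equiv> prod_encode (\<Psi> [], p)"
  shows "(\<lambda>n. \<Psi> (pre f n)) \<longlonglongrightarrow> l \<Longrightarrow> (\<lambda>n. learner e (pre f n)) \<longlonglongrightarrow> l"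
    and "indx (learner e) f \<subseteq> indx \<Psi> f"
    and "ecard (mcl (learner e) f) \<le> ecard (mcl \<Psi> f)"
proof -
  assume "(\<lambda>n. \<Psi> (pre f n)) \<longlonglongrightarrow> l"
  then have "eventually (\<lambda>n. \<Psi> (pre f n) = l) sequentially" by (simp add: tendsto_discrete)
  then obtain n0 where "\<And>n. n \<ge> n0 \<Longrightarrow> \<Psi> (pre f n) = l" by (auto simp: eventually_sequentially)
  then show "(\<lambda>n. learner e (pre f n)) \<longlonglongrightarrow> l"
    unfolding e_def using total by (intro learner_dominates_partial[of n0]) metis
next
  have pre0: "pre f 0 = []" by (simp add: pre_def)
  have "\<exists>m. learner e (pre f n) = \<Psi> (pre f m) \<and>
     (m = 0 \<or> run n (\<lambda>_. 0) p (list_encode (pre f m)) \<noteq> None) \<and> m \<le> n \<and>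
     (\<forall>i\<le>n. run n (\<lambda>_. 0) p (list_encode (pre f i)) \<noteq> None \<longrightarrow> i \<le> m)" for n
  proof (cases rule: learner_cases[of "\<Psi> []" p f n])
    case default
    then show ?thesis by (intro exI[of _ 0]) (auto simp: e_def pre0)
  next
    case (found m)
    then have "learner e (pre f n) = \<Psi> (pre f m)"
      using total computes_fun by (metis computes_def e_def)
    then show ?thesis using found by (intro exI[of _ m]) auto
  qed
  then obtain h where h: "\<And>n. learner e (pre f n) = \<Psi> (pre f (h n))"
    and hr: "\<And>n. h n = 0 \<or> run n (\<lambda>_. 0) p (list_encode (pre f (h n))) \<noteq> None"
    and hn: "\<And>n. h n \<le> n"
    and hi: "\<And>n i. i \<le> n \<Longrightarrow> run n (\<lambda>_. 0) p (list_encode (pre f i)) \<noteq> None \<Longrightarrow> i \<le> h n"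
    by metis
  show "indx (learner e) f \<subseteq> indx \<Psi> f" by (auto simp: indx_def h)
  have step: "h n \<le> h (Suc n)" for n
  proof (cases "h n = 0")
    case False
    then obtain y where "run n (\<lambda>_. 0) p (list_encode (pre f (h n))) = Some y" using hr[of n] by auto
    then have "run (Suc n) (\<lambda>_. 0) p (list_encode (pre f (h n))) = Some y" by (rule run_Suc)
    then show ?thesis using hi[of "h n" "Suc n"] hn[of n] by (metis le_SucI option.distinct(1))
  qed simp
  have mono: "a \<le> b \<Longrightarrow> h a \<le> h b" for a b using step by (rule lift_Suc_mono_le)
  have "\<exists>j. h n \<le> j \<and> j < h (Suc n) \<and> j \<in> mcl \<Psi> f" if "n \<in> mcl (learner e) f" for n
  proof (rule ccontr)
    assume no: "\<not> ?thesis"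
    have "h n \<le> j \<Longrightarrow> j \<le> h (Suc n) \<Longrightarrow> \<Psi> (pre f j) = \<Psi> (pre f (h n))" for j
    proof (induction j rule: dec_induct)
      case (step j)
      then have "j \<notin> mcl \<Psi> f" using no by auto
      then show ?case using step by (simp add: mcl_def)
    qed simp
    then have "\<Psi> (pre f (h (Suc n))) = \<Psi> (pre f (h n))" using step by blast
    then show False using that by (simp add: mcl_def h)
  qed
  then obtain j where j: "\<And>n. n \<in> mcl (learner e) f \<Longrightarrow> h n \<le> j n \<and> j n < h (Suc n) \<and> j n \<in> mcl \<Psi> f"
    by metis
  have "j a < j b" if "a \<in> mcl (learner e) f" "b \<in> mcl (learner e) f" "a < b" for a b
    using j[OF that(1)] j[OF that(2)] mono[of "Suc a" b] that(3) by linarith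
  then have inj: "inj_on j (mcl (learner e) f)" by (metis inj_onI nat_neq_iff)
  have sub: "j ` mcl (learner e) f \<subseteq> mcl \<Psi> f" using j by auto
  show "ecard (mcl (learner e) f) \<le> ecard (mcl \<Psi> f)"
    using inj sub by (auto simp: ecard_def intro: card_inj_on_le dest: inj_on_finite)
qed

end

theory Submission
  imports Defs
begin

text \<open>
  A learner with finitely many mind changes sorts each \<open>g\<close> by a number that it computes in the limit:
  the number of its mind changes (a \<open>\<Pi>\<^sup>0\<^sub>1\<close> layer), the stage of its last mind change (a \<open>\<Pi>\<^sup>0\<^sub>1\<close>
  partition), or the position of its final hypothesis in the order in which hypotheses first appear
  (a partition that is \<open>\<Sigma>\<^sup>0\<^sub>2\<close> and \<open>\<Pi>\<^sup>0\<^sub>2\<close> on the domain).  Knowing that number, a program with oracle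
  \<open>g\<close> can search for the final hypothesis and run it.  Conversely, a learner for a \<open>\<Sigma>\<^sup>0\<^sub>2\<close> cover always
  trusts the least pair (piece, \<open>\<Sigma>\<^sup>0\<^sub>2\<close> witness) that is not yet refuted, and a learner for \<open>\<Pi>\<^sup>0\<^sub>1\<close> layers
  the least layer that is not yet refuted.  Without mind changes a learner is just a constant index.

  All of this needs \<^const>\<open>learner\<close> to be computable, hence a program for the depth-bounded evaluator
  \<^const>\<open>run\<close> with oracle 0.  It is written with general recursion, which the scheme \<^const>\<open>Interp\<close>
  provides by self-application.
\<close>

subsection \<open>Programs\<close>


text \<open>Each sorting number has to respect the bounded resource and also to certify a final
  hypothesis. Once the known total of mind changes has been counted, no change is left; at the known
  stage the learner has settled; and hypotheses in the same position of the order of appearance are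
  equal, so even an early occurrence of the final one will do. The position replaces the hypothesis
  itself because pieces must be numbered below \<open>k\<close>. Pieces have to be correct only on
  \<open>dom \<Gamma>\<close>, where limits exist. There "eventually" and "infinitely often" agree,
  elsewhere they may differ; hence a bound on hypotheses yields a Sigma-0-2 and a Pi-0-2 family that
  agree on the domain rather than one Delta-0-2 family. Oracles are an obstacle: a program
  witnessing \<open>computable\<close> is correct with oracle 0, but it may query its oracle and so
  cannot simply be run with oracle \<open>g\<close>. It has to be simulated, and the evaluator that
  the learners require serves for this too.\<close>

declare run.simps [simp del]

abbreviation fst_code :: "nat \<Rightarrow> nat" where "fst_code x \<equiv> fst (prod_decode x)"
abbreviation snd_code :: "nat \<Rightarrow> nat" where "snd_code x \<equiv> snd (prod_decode x)"

section \<open>Computation rules of the schemes\<close>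

lemma computes_basic:
  "computes g (prod_encode (0, d)) x 0"
  "computes g (prod_encode (1, d)) x (Suc x)"
  "computes g (prod_encode (2, d)) x (fst_code x)"
  "computes g (prod_encode (3, d)) x (snd_code x)"
  "computes g (prod_encode (4, d)) x (g x)"
  "computes g (prod_encode (10, d)) x x"
  unfolding computes_def
  by (rule exI[of _ 1]; simp add: run.simps scheme_of_def Let_def split: prod.splits)+

lemma computes_Tuple:
  assumes "computes g a x u" "computes g b x v"
  shows "computes g (prod_encode (5, prod_encode (a, b))) x (prod_encode (u, v))"
proof -
  obtain s t where "run s g a x = Some u" "run t g b x = Some v"
    using assms by (auto simp: computes_def)
  then have "run (max s t) g a x = Some u" "run (max s t) g b x = Some v"
    by (auto intro: run_mono)
  then show ?thesis unfolding computes_def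
    by (intro exI[of _ "Suc (max s t)"]) (simp add: run.simps scheme_of_def split: prod.splits)
qed

lemma computes_Comp:
  assumes "computes g b x u" "computes g a u v"
  shows "computes g (prod_encode (6, prod_encode (a, b))) x v"
proof -
  obtain s t where "run s g b x = Some u" "run t g a u = Some v"
    using assms by (auto simp: computes_def)
  then have "run (max s t) g b x = Some u" "run (max s t) g a u = Some v"
    by (auto intro: run_mono)
  then show ?thesis unfolding computes_def
    by (intro exI[of _ "Suc (max s t)"]) (simp add: run.simps scheme_of_def split: prod.splits)
qed

lemma computes_Rec:
  assumes "computes g a x z"
    and "\<And>m r. computes g b (prod_encode (r, prod_encode (x, m))) (h m r)"
  shows "computes g (prod_encode (7, prod_encode (a, b))) (prod_encode (x, n)) (rec_nat z h n)"
proof (induction n)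
  case 0
  obtain s where "run s g a x = Some z" using assms by (auto simp: computes_def)
  then show ?case unfolding computes_def
    by (intro exI[of _ "Suc s"]) (simp add: run.simps scheme_of_def)
next
  case (Suc n)
  obtain s t where "run s g (prod_encode (7, prod_encode (a, b))) (prod_encode (x, n))
      = Some (rec_nat z h n)"
    "run t g b (prod_encode (rec_nat z h n, prod_encode (x, n))) = Some (h n (rec_nat z h n))"
    using Suc assms(2) unfolding computes_def by metis
  then have "run (max s t) g (prod_encode (7, prod_encode (a, b))) (prod_encode (x, n))
      = Some (rec_nat z h n)"
    "run (max s t) g b (prod_encode (rec_nat z h n, prod_encode (x, n))) = Some (h n (rec_nat z h n))"
    by (auto intro: run_mono)
  then show ?case unfolding computes_def
    by (intro exI[of _ "Suc (max s t)"]) (simp add: run.simps scheme_of_def)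
qed

text \<open>The scheme stops at the value 0, so its test program computes the negation of
  \<open>P\<close>. It calls itself on larger arguments; the induction therefore runs backwards,
  over the distance \<open>j\<close> from the least solution.\<close>

lemma computes_Mu:
  assumes "\<And>n. computes g a (prod_encode (x, n)) (of_bool (\<not> P n))" and "P k"
  shows "computes g (prod_encode (8, a)) (prod_encode (x, 0)) (LEAST n. P n)"
proof -
  have "computes g (prod_encode (8, a)) (prod_encode (x, (LEAST n. P n) - j)) (LEAST n. P n)"
    if "j \<le> (LEAST n. P n)" for j
    using that
  proof (induction j)
    case 0
    obtain s where "run s g a (prod_encode (x, LEAST n. P n)) = Some 0"
      using assms(1)[of "LEAST n. P n"] LeastI[of P, OF assms(2)] by (auto simp: computes_def)
    then show ?case unfolding computes_def
      by (intro exI[of _ "Suc s"]) (simp add: run.simps scheme_of_def)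
  next
    case (Suc j)
    let ?n = "(LEAST n. P n) - Suc j"
    have n: "Suc ?n = (LEAST n. P n) - j" using Suc.prems by simp
    have "\<not> P ?n" using Suc.prems by (intro not_less_Least) simp
    then obtain s where "run s g a (prod_encode (x, ?n)) = Some 1"
      using assms(1)[of ?n] by (auto simp: computes_def)
    moreover obtain t where
      "run t g (prod_encode (8, a)) (prod_encode (x, Suc ?n)) = Some (LEAST n. P n)"
      using Suc n by (auto simp: computes_def)
    ultimately have "run (max s t) g a (prod_encode (x, ?n)) = Some 1"
      "run (max s t) g (prod_encode (8, a)) (prod_encode (x, Suc ?n)) = Some (LEAST n. P n)"
      by (auto intro: run_mono)
    then show ?case unfolding computes_def
      by (intro exI[of _ "Suc (max s t)"]) (simp add: run.simps scheme_of_def)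
  qed
  from this[of "LEAST n. P n"] show ?thesis by simp
qed

lemma computes_Interp:
  assumes "computes g e x y"
  shows "computes g (prod_encode (9, d)) (prod_encode (e, x)) y"
proof -
  obtain s where "run s g e x = Some y" using assms by (auto simp: computes_def)
  then show ?thesis unfolding computes_def
    by (intro exI[of _ "Suc s"]) (simp add: run.simps scheme_of_def split: prod.splits)
qed

text \<open>Hard-wires a number into a program. Since the index is itself computable from
  \<open>n\<close>, parameters can be moved into indices effectively.\<close>

fun const_index :: "nat \<Rightarrow> nat" where
  "const_index 0 = prod_encode (0, 0)"
| "const_index (Suc n) = prod_encode (6, prod_encode (prod_encode (1, 0), const_index n))"

lemma computes_const: "computes g (const_index n) x n"
  by (induction n) (auto intro: computes_basic(1) computes_Comp computes_basic(2)[simplified])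

text \<open>The predicate \<open>C\<close> restricts the oracles and inputs, so that partial computations (unbounded search,
  recursive calls, running a program that need not halt) fit into the same calculus as total ones.\<close>

definition effective_on :: "(baire \<Rightarrow> nat \<Rightarrow> bool) \<Rightarrow> (baire \<Rightarrow> nat \<Rightarrow> nat) \<Rightarrow> bool" where
  "effective_on C F \<longleftrightarrow> (\<exists>e. \<forall>g x. C g x \<longrightarrow> computes g e x (F g x))"

abbreviation effective :: "(baire \<Rightarrow> nat \<Rightarrow> nat) \<Rightarrow> bool" where
  "effective \<equiv> effective_on (\<lambda>_ _. True)"

section \<open>Closure rules for effective functions\<close>

named_theorems effective_intros

lemma effective_on_mono:
  "effective_on C F \<Longrightarrow> (\<And>g x. D g x \<Longrightarrow> C g x) \<Longrightarrow> effective_on D F"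
  unfolding effective_on_def by blast

lemma effective_on_cong:
  "effective_on C F \<Longrightarrow> (\<And>g x. C g x \<Longrightarrow> F g x = G g x) \<Longrightarrow> effective_on C G"
  unfolding effective_on_def by metis

lemma effective_on_comp:
  assumes "effective_on D F" "effective_on C G" "\<And>g x. C g x \<Longrightarrow> D g (G g x)"
  shows "effective_on C (\<lambda>g x. F g (G g x))"
proof -
  obtain a b where "\<And>g x. D g x \<Longrightarrow> computes g a x (F g x)" "\<And>g x. C g x \<Longrightarrow> computes g b x (G g x)"
    using assms unfolding effective_on_def by blast
  then show ?thesis unfolding effective_on_def using assms(3) computes_Comp by meson
qed

lemmas effective_comp = effective_on_comp[where D = "\<lambda>_ _. True", OF _ _ TrueI]

lemma effective_on_id [effective_intros]: "effective_on C (\<lambda>g x. x)"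
  unfolding effective_on_def using computes_basic(6) by blast

lemma effective_on_const [effective_intros]: "effective_on C (\<lambda>g x. c)"
  unfolding effective_on_def using computes_const by blast

lemma effective_on_Suc [effective_intros]:
  "effective_on C F \<Longrightarrow> effective_on C (\<lambda>g x. Suc (F g x))"
  by (rule effective_comp[where F = "\<lambda>_. Suc"])
    (use computes_basic(2) in \<open>auto simp: effective_on_def simp del: One_nat_def\<close>)

lemma effective_on_fst [effective_intros]:
  "effective_on C F \<Longrightarrow> effective_on C (\<lambda>g x. fst_code (F g x))"
  by (rule effective_comp[where F = "\<lambda>_. fst_code"])
    (use computes_basic(3) in \<open>auto simp: effective_on_def\<close>)

lemma effective_on_snd [effective_intros]:
  "effective_on C F \<Longrightarrow> effective_on C (\<lambda>g x. snd_code (F g x))"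
  by (rule effective_comp[where F = "\<lambda>_. snd_code"])
    (use computes_basic(4) in \<open>auto simp: effective_on_def\<close>)

lemma effective_on_oracle [effective_intros]:
  "effective_on C F \<Longrightarrow> effective_on C (\<lambda>g x. g (F g x))"
  by (rule effective_comp[where F = "\<lambda>g. g"])
    (use computes_basic(5) in \<open>auto simp: effective_on_def\<close>)

lemma effective_on_pair [effective_intros]:
  assumes "effective_on C F" "effective_on C G"
  shows "effective_on C (\<lambda>g x. prod_encode (F g x, G g x))"
proof -
  obtain a b where "\<And>g x. C g x \<Longrightarrow> computes g a x (F g x)" "\<And>g x. C g x \<Longrightarrow> computes g b x (G g x)"
    using assms unfolding effective_on_def by blast
  then show ?thesis unfolding effective_on_def using computes_Tuple by meson
qed

text \<open>The program may be computed from the data, and it has to be correct only at the one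
  input and oracle where it is run. Lazy case distinction, recursive calls and the running of a
  learned hypothesis all pass through this rule.\<close>

lemma effective_on_interp:
  assumes "effective_on C P" "effective_on C X"
    and "\<And>g x. C g x \<Longrightarrow> computes g (P g x) (X g x) (F g x)"
  shows "effective_on C F"
proof -
  have "effective_on C (\<lambda>g x. prod_encode (P g x, X g x))"
    using assms by (intro effective_intros)
  then obtain a where "\<And>g x. C g x \<Longrightarrow> computes g a x (prod_encode (P g x, X g x))"
    unfolding effective_on_def by blast
  then show ?thesis unfolding effective_on_def
    using computes_Comp computes_Interp assms(3) by meson
qed

text \<open>The step reads the coded triple \<open>(r, (x, m))\<close> that the scheme
  \<open>Rec\<close> supplies: previous value, parameter and counter.\<close>

lemma effective_on_rec [effective_intros]:
  assumes "effective_on C A"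
    and "effective_on (\<lambda>g z. C g (fst_code (snd_code z)))
      (\<lambda>g z. H g (fst_code (snd_code z)) (snd_code (snd_code z)) (fst_code z))"
    and "effective_on C N"
  shows "effective_on C (\<lambda>g x. rec_nat (A g x) (H g x) (N g x))"
proof -
  obtain a b where a: "\<And>g x. C g x \<Longrightarrow> computes g a x (A g x)"
    and b: "\<And>g x m r. C g x \<Longrightarrow> computes g b (prod_encode (r, prod_encode (x, m))) (H g x m r)"
    using assms(1,2) unfolding effective_on_def by (metis fst_conv prod_encode_inverse snd_conv)
  have "effective_on C (\<lambda>g x. prod_encode (x, N g x))"
    using assms by (intro effective_intros)
  then obtain d where "\<And>g x. C g x \<Longrightarrow> computes g d x (prod_encode (x, N g x))"
    unfolding effective_on_def by blast
  then show ?thesis unfolding effective_on_def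
    using computes_Comp computes_Rec[OF a b] by meson
qed

text \<open>Computing both branches and selecting a value would diverge whenever the rejected branch
  does. Instead the index of the right branch is selected, by a recursion of length 0 or 1, and only
  that program is interpreted.\<close>

lemma effective_on_if_lazy:
  assumes "effective_on C (\<lambda>g x. of_bool (P g x))"
    and "effective_on (\<lambda>g x. C g x \<and> P g x) A" and "effective_on (\<lambda>g x. C g x \<and> \<not> P g x) B"
  shows "effective_on C (\<lambda>g x. if P g x then A g x else B g x)"
proof -
  obtain a b where ab: "\<And>g x. C g x \<Longrightarrow> P g x \<Longrightarrow> computes g a x (A g x)"
    "\<And>g x. C g x \<Longrightarrow> \<not> P g x \<Longrightarrow> computes g b x (B g x)"
    using assms(2,3) unfolding effective_on_def by blast
  have "effective_on C (\<lambda>g x. rec_nat b (\<lambda>_ _. a) (of_bool (P g x)))"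
    by (intro effective_intros assms)
  then have "effective_on C (\<lambda>g x. if P g x then a else b)"
    by (rule effective_on_cong) auto
  then show ?thesis using effective_on_id by (rule effective_on_interp) (use ab in auto)
qed

lemma effective_on_if [effective_intros]:
  assumes "effective_on C (\<lambda>g x. of_bool (P g x))" "effective_on C A" "effective_on C B"
  shows "effective_on C (\<lambda>g x. if P g x then A g x else B g x)"
  using assms by (intro effective_on_if_lazy) (auto elim: effective_on_mono)

lemma effective_on_not [effective_intros]:
  assumes "effective_on C (\<lambda>g x. of_bool (P g x))"
  shows "effective_on C (\<lambda>g x. of_bool (\<not> P g x))"
proof -
  have "effective_on C (\<lambda>g x. if P g x then 0 else 1)" by (intro effective_intros assms)
  then show ?thesis by (rule effective_on_cong) auto
qed

lemma effective_on_conj [effective_intros]: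
  assumes "effective_on C (\<lambda>g x. of_bool (P g x))" "effective_on C (\<lambda>g x. of_bool (Q g x))"
  shows "effective_on C (\<lambda>g x. of_bool (P g x \<and> Q g x))"
proof -
  have "effective_on C (\<lambda>g x. if P g x then of_bool (Q g x) else 0)" by (intro effective_intros assms)
  then show ?thesis by (rule effective_on_cong) auto
qed

lemma effective_on_disj [effective_intros]:
  assumes "effective_on C (\<lambda>g x. of_bool (P g x))" "effective_on C (\<lambda>g x. of_bool (Q g x))"
  shows "effective_on C (\<lambda>g x. of_bool (P g x \<or> Q g x))"
proof -
  have "effective_on C (\<lambda>g x. if P g x then 1 else of_bool (Q g x))" by (intro effective_intros assms)
  then show ?thesis by (rule effective_on_cong) auto
qed

lemma effective_on_imp [effective_intros]:
  assumes "effective_on C (\<lambda>g x. of_bool (P g x))" "effective_on C (\<lambda>g x. of_bool (Q g x))"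
  shows "effective_on C (\<lambda>g x. of_bool (P g x \<longrightarrow> Q g x))"
  unfolding imp_conv_disj by (intro effective_intros assms)

lemma effective_on_diff [effective_intros]:
  assumes "effective_on C F" "effective_on C G"
  shows "effective_on C (\<lambda>g x. F g x - G g x)"
proof -
  \<comment> \<open>The inner recursion returns its last counter and so is the predecessor;
    iterating it gives truncated subtraction.\<close>
  have "effective_on C (\<lambda>g x. rec_nat (F g x) (\<lambda>_ r. rec_nat 0 (\<lambda>m _. m) r) (G g x))"
    by (intro effective_intros assms)
  moreover have "rec_nat 0 (\<lambda>m _. m) r = r - 1" for r :: nat by (cases r) auto
  moreover have "rec_nat a (\<lambda>_ r. r - 1) b = a - b" for a b :: nat by (induction b) auto
  ultimately show ?thesis by simp
qed

lemma effective_on_add [effective_intros]: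
  assumes "effective_on C F" "effective_on C G"
  shows "effective_on C (\<lambda>g x. F g x + G g x)"
proof -
  have "effective_on C (\<lambda>g x. rec_nat (F g x) (\<lambda>_ r. Suc r) (G g x))"
    by (intro effective_intros assms)
  moreover have "rec_nat a (\<lambda>_ r. Suc r) b = a + b" for a b :: nat by (induction b) auto
  ultimately show ?thesis by simp
qed

lemma effective_on_le [effective_intros]:
  assumes "effective_on C F" "effective_on C G"
  shows "effective_on C (\<lambda>g x. of_bool (F g x \<le> G g x))"
proof -
  have "effective_on C (\<lambda>g x. 1 - (F g x - G g x))"
    by (intro effective_intros assms)
  then show ?thesis by (rule effective_on_cong) auto
qed

lemma effective_on_less [effective_intros]:
  assumes "effective_on C F" "effective_on C G"
  shows "effective_on C (\<lambda>g x. of_bool (F g x < G g x))"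
  unfolding less_eq_Suc_le by (intro effective_intros assms)

lemma effective_on_eq [effective_intros]:
  assumes "effective_on C F" "effective_on C G"
  shows "effective_on C (\<lambda>g x. of_bool (F g x = G g x))"
  unfolding order_eq_iff by (intro effective_intros assms)

lemma effective_on_sum [effective_intros]:
  assumes "effective_on C N"
    and "effective_on (\<lambda>g z. C g (fst_code z)) (\<lambda>g z. F g (fst_code z) (snd_code z))"
  shows "effective_on C (\<lambda>g x. \<Sum>n<N g x. F g x n)"
proof -
  \<comment> \<open>The recursion supplies \<open>(r, (x, m))\<close>; composing with
    \<open>snd_code\<close> hands the summand the pair \<open>(x, m)\<close> that it
    expects.\<close>
  have "effective_on C (\<lambda>g x. rec_nat 0 (\<lambda>m r. r + F g x m) (N g x))"
    by (intro effective_intros assms effective_on_comp[OF assms(2),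
      where G = "\<lambda>g z. snd_code z", simplified])
  moreover have "rec_nat 0 (\<lambda>m r. r + h m) n = (\<Sum>m<n. h m)" for h :: "nat \<Rightarrow> nat" and n
    by (induction n) auto
  ultimately show ?thesis by simp
qed

lemma effective_on_Least:
  assumes "effective_on (\<lambda>g z. C g (fst_code z)) (\<lambda>g z. of_bool (P g (fst_code z) (snd_code z)))"
    and "\<And>g x. C g x \<Longrightarrow> \<exists>n. P g x n"
  shows "effective_on C (\<lambda>g x. LEAST n. P g x n)"
proof -
  have "effective_on (\<lambda>g z. C g (fst_code z)) (\<lambda>g z. of_bool (\<not> P g (fst_code z) (snd_code z)))"
    by (intro effective_intros assms)
  then obtain a where a: "\<And>g x n. C g x \<Longrightarrow> computes g a (prod_encode (x, n)) (of_bool (\<not> P g x n))"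
    unfolding effective_on_def by (metis fst_conv prod_encode_inverse snd_conv)
  have "effective_on C (\<lambda>g x. prod_encode (x, 0))" by (intro effective_intros)
  then obtain d where d: "\<And>g x. C g x \<Longrightarrow> computes g d x (prod_encode (x, 0))"
    unfolding effective_on_def by blast
  have "computes g (prod_encode (6, prod_encode (prod_encode (8, a), d))) x (LEAST n. P g x n)"
    if C: "C g x" for g x
  proof -
    obtain k where "P g x k" using assms(2)[OF C] by blast
    then show ?thesis using computes_Mu[OF a[OF C]] by (intro computes_Comp[OF d[OF C]])
  qed
  then show ?thesis unfolding effective_on_def by blast
qed

lemma effective_on_all_less [effective_intros]:
  assumes "effective_on C N"
    and "effective_on (\<lambda>g z. C g (fst_code z)) (\<lambda>g z. of_bool (P g (fst_code z) (snd_code z)))"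
  shows "effective_on C (\<lambda>g x. of_bool (\<forall>n<N g x. P g x n))"
proof -
  have "effective_on C (\<lambda>g x. of_bool ((\<Sum>n<N g x. of_bool (\<not> P g x n)) = (0 :: nat)))"
    by (intro effective_intros assms)
  then show ?thesis by (rule effective_on_cong) auto
qed

lemma effective_on_all_le [effective_intros]:
  assumes "effective_on C N"
    and "effective_on (\<lambda>g z. C g (fst_code z)) (\<lambda>g z. of_bool (P g (fst_code z) (snd_code z)))"
  shows "effective_on C (\<lambda>g x. of_bool (\<forall>n\<le>N g x. P g x n))"
  unfolding less_Suc_eq_le[symmetric] by (intro effective_intros assms)


lemma effective_computable: "effective (\<lambda>g. f) \<Longrightarrow> computable f"
  unfolding effective_on_def computable_def by blast

text \<open>General recursion: the body receives on input \<open>(q, x)\<close> a program \<open>q\<close> which, applied to \<open>(q, y)\<close>,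
  answers recursive calls at arguments \<open>y\<close> of smaller measure; it is then applied to its own index.\<close>

lemma effective_self_application:
  fixes m :: "nat \<Rightarrow> nat"
  assumes "effective_on (\<lambda>g z. \<forall>y. m y < m (snd_code z) \<longrightarrow>
      computes g (fst_code z) (prod_encode (fst_code z, y)) (f y)) (\<lambda>g z. f (snd_code z))"
    (is "effective_on ?C _")
  shows "effective (\<lambda>g. f)"
proof -
  obtain b where b: "\<And>g z. ?C g z \<Longrightarrow> computes g b z (f (snd_code z))"
    using assms unfolding effective_on_def by blast
  have self: "computes g b (prod_encode (b, x)) (f x)" for g x
  proof (induction x rule: measure_induct_rule[of m])
    case (less x)
    then show ?case using b[of "prod_encode (b, x)" g] by simp
  qed
  show ?thesis
    by (rule effective_on_interp[of _ "\<lambda>_ _. b" "\<lambda>_ x. prod_encode (b, x)"])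
      (intro effective_intros self)+
qed

subsection \<open>The evaluator with oracle 0\<close>

text \<open>Reserves 0 for \<open>None\<close>, so that not having halted within the given depth is
  a value that a program can test.\<close>

definition option_code :: "nat option \<Rightarrow> nat" where
  "option_code r = (case r of None \<Rightarrow> 0 | Some y \<Rightarrow> Suc y)"

lemma option_code_simps [simp]: "option_code None = 0" "option_code (Some y) = Suc y"
  by (simp_all add: option_code_def)

lemma option_code_bind:
  "option_code (Option.bind r h) = (if option_code r = 0 then 0 else option_code (h (option_code r - 1)))"
  by (cases r) auto

text \<open>The depth is the outermost component, so that \<open>fst_code\<close> can serve as the
  measure of the recursion.\<close>

definition bounded_run :: "nat \<Rightarrow> nat" where
  "bounded_run z = option_code (run (fst_code z) (\<lambda>_. 0) (fst_code (snd_code z)) (snd_code (snd_code z)))"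

lemma option_code_run:
  "option_code (run s (\<lambda>_. 0) e x) = bounded_run (prod_encode (s, prod_encode (e, x)))"
  by (simp add: bounded_run_def)

text \<open>Written so that every recursive call has the form \<open>call i u\<close>, at the
  smaller depth \<open>s\<close>: this is the shape that self-application can answer. The oracle
  case is the constant code of \<open>Some 0\<close>.\<close>

lemma bounded_run_rec:
  "bounded_run z = (if fst_code z = 0 then 0 else
     let s = fst_code z - 1; e = fst_code (snd_code z); x = snd_code (snd_code z);
         t = fst_code e; d = snd_code e; a = fst_code d; b = snd_code d;
         y = fst_code x; n = snd_code x;
         call = (\<lambda>i u. bounded_run (prod_encode (s, prod_encode (i, u)))) in
     if t = 0 then Suc 0 else if t = 1 then Suc (Suc x) else if t = 2 then Suc y
     else if t = 3 then Suc n else if t = 4 then Suc 0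
     else if t = 5 then if call a x = 0 then 0 else if call b x = 0 then 0
       else Suc (prod_encode (call a x - 1, call b x - 1))
     else if t = 6 then if call b x = 0 then 0 else call a (call b x - 1)
     else if t = 7 then if n = 0 then call a y
       else if call e (prod_encode (y, n - 1)) = 0 then 0
       else call b (prod_encode (call e (prod_encode (y, n - 1)) - 1, prod_encode (y, n - 1)))
     else if t = 8 then if call d x = 0 then 0 else if call d x = 1 then Suc n
       else call e (prod_encode (y, Suc n))
     else if t = 9 then call y n else Suc x)"
proof (cases "fst_code z")
  case 0
  then show ?thesis by (simp add: bounded_run_def run.simps)
next
  case (Suc s)
  obtain e x where z: "snd_code z = prod_encode (e, x)" by (metis prod.exhaust prod_decode_inverse)
  obtain t d where e: "e = prod_encode (t, d)" by (metis prod.exhaust prod_decode_inverse)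
  obtain a b where d: "d = prod_encode (a, b)" by (metis prod.exhaust prod_decode_inverse)
  obtain y n where x: "x = prod_encode (y, n)" by (metis prod.exhaust prod_decode_inverse)
  consider "t = 0" | "t = 1" | "t = 2" | "t = 3" | "t = 4" | "t = 5" | "t = 6" | "t = 7" | "t = 8"
    | "t = 9" | "t > 9" by force
  then show ?thesis
    unfolding bounded_run_def[of z] Suc z
    by cases (simp_all add: run.simps scheme_of_def e d x option_code_bind option_code_run Let_def
      split: nat.splits)
qed

lemma effective_bounded_run: "effective (\<lambda>g. bounded_run)"
proof (rule effective_self_application[of fst_code])
  let ?C = "\<lambda>g z. \<forall>y. fst_code y < fst_code (snd_code z) \<longrightarrow>
    computes g (fst_code z) (prod_encode (fst_code z, y)) (bounded_run y)"
  \<comment> \<open>Calls at depth \<open>d - 1\<close> have smaller measure only if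
    \<open>d\<close> is not 0; the lazy case distinction supplies this second condition.\<close>
  let ?D = "\<lambda>g z. ?C g z \<and> \<not> fst_code (snd_code z) = 0"
  have call: "effective_on ?D (\<lambda>g z. bounded_run (prod_encode (fst_code (snd_code z) - 1, prod_encode (E g z, X g z))))"
    if "effective_on ?D E" "effective_on ?D X" for E X
    by (rule effective_on_interp[of _ "\<lambda>g z. fst_code z"
        "\<lambda>g z. prod_encode (fst_code z, prod_encode (fst_code (snd_code z) - 1, prod_encode (E g z, X g z)))"])
      (use that in \<open>auto intro!: effective_intros\<close>)
  show "effective_on ?C (\<lambda>g z. bounded_run (snd_code z))"
    by (subst bounded_run_rec, unfold Let_def, rule effective_on_if_lazy)
      (intro effective_intros call)+
qed

lemma effective_on_run [effective_intros]:
  assumes "effective_on C S" "effective_on C E" "effective_on C X"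
  shows "effective_on C (\<lambda>g x. option_code (run (S g x) (\<lambda>_. 0) (E g x) (X g x)))"
  unfolding option_code_run
  by (rule effective_comp[OF effective_bounded_run]) (intro effective_intros assms)

text \<open>The program for \<open>f\<close> is known to be correct only with oracle 0, while the
  surrounding computation has oracle \<open>g\<close>. Hence it is not run but simulated: search for
  a sufficient depth, then read the value off the evaluator with oracle 0.\<close>

lemma computable_effective_on:
  assumes "computable f" "effective_on C F"
  shows "effective_on C (\<lambda>g x. f (F g x))"
proof -
  obtain e where e: "\<And>x. computes (\<lambda>_. 0) e x (f x)" using assms(1) unfolding computable_def by blast
  let ?halt = "\<lambda>x s. option_code (run s (\<lambda>_. 0) e x) \<noteq> 0"
  have ex: "\<exists>s. ?halt x s" for x
    using e[of x] unfolding computes_def by (metis option_code_simps(2) nat.distinct(1))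
  have "effective (\<lambda>g x. LEAST s. ?halt x s)"
    by (intro effective_on_Least effective_intros ex)
  then have "effective (\<lambda>g x. option_code (run (LEAST s. ?halt x s) (\<lambda>_. 0) e x) - 1)"
    by (intro effective_intros)
  moreover have "option_code (run (LEAST s. ?halt x s) (\<lambda>_. 0) e x) - 1 = f x" for x
  proof -
    have "?halt x (LEAST s. ?halt x s)" using ex by (rule LeastI_ex)
    then obtain y where y: "run (LEAST s. ?halt x s) (\<lambda>_. 0) e x = Some y" by fastforce
    then have "y = f x" using e computes_fun unfolding computes_def by metis
    then show ?thesis using y by simp
  qed
  ultimately have "effective (\<lambda>g. f)" by simp
  then show ?thesis using assms(2) by (rule effective_comp)
qed

lemma computable_const_index: "computable const_index"
proof -
  have "effective (\<lambda>g x. rec_nat (prod_encode (0, 0))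
    (\<lambda>_ r. prod_encode (6, prod_encode (prod_encode (1, 0), r))) x)"
    by (intro effective_intros)
  moreover have "rec_nat (prod_encode (0, 0))
    (\<lambda>_ r. prod_encode (6, prod_encode (prod_encode (1, 0), r))) n = const_index n" for n
    by (induction n) auto
  ultimately show ?thesis by (auto intro: effective_computable)
qed

text \<open>Kleene's s-m-n theorem with one parameter, for computations that need to converge only
  under \<open>C\<close>.\<close>

lemma parameter_theorem:
  assumes "effective_on C F"
  shows "\<exists>e. computable e \<and>
    (\<forall>i g x. C g (prod_encode (i, x)) \<longrightarrow> computes g (e i) x (F g (prod_encode (i, x))))"
proof -
  obtain a where a: "\<And>g x. C g x \<Longrightarrow> computes g a x (F g x)"
    using assms unfolding effective_on_def by blast
  \<comment> \<open>Feeds the pair of the constant \<open>i\<close> and the input to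
    \<open>a\<close>; tag 10 decodes to \<open>Ident\<close>.\<close>
  define e where "e i = prod_encode (6, prod_encode (a,
    prod_encode (5, prod_encode (const_index i, prod_encode (10, 0)))))" for i
  have "computable e" unfolding e_def
    by (intro effective_computable effective_intros computable_effective_on[OF computable_const_index])
  moreover have "computes g (e i) x (F g (prod_encode (i, x)))" if "C g (prod_encode (i, x))" for i g x
    unfolding e_def by (intro computes_Comp[OF computes_Tuple[OF computes_const computes_basic(6)]] a that)
  ultimately show ?thesis by blast
qed

subsection \<open>Strings and learners\<close>

lemma effective_on_list_decode [effective_intros]:
  "effective_on C F \<Longrightarrow> effective_on C (\<lambda>g x. list_encode (list_decode (F g x)))"
  by simp

lemma effective_on_Cons [effective_intros]:
  "effective_on C F \<Longrightarrow> effective_on C (\<lambda>g x. list_encode (L g x)) \<Longrightarrow>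
    effective_on C (\<lambda>g x. list_encode (F g x # L g x))"
  unfolding list_encode.simps by (intro effective_intros)

lemma list_encode_tl: "list_encode (tl l) = snd_code (list_encode l - 1)"
proof (cases l)
  case Nil
  \<comment> \<open>The empty list has code 0, truncated subtraction leaves it at 0, and 0 decodes
    to \<open>(0, 0)\<close>; so the formula also returns the empty tail here.\<close>
  have "prod_decode (prod_encode (0, 0)) = (0, 0)" by simp
  then have "prod_decode 0 = (0, 0)" by (simp add: prod_encode_def)
  then show ?thesis using Nil by simp
qed simp

lemma effective_on_tl [effective_intros]:
  "effective_on C (\<lambda>g x. list_encode (L g x)) \<Longrightarrow> effective_on C (\<lambda>g x. list_encode (tl (L g x)))"
  unfolding list_encode_tl by (intro effective_intros)

lemma effective_on_drop [effective_intros]: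
  assumes "effective_on C N" "effective_on C (\<lambda>g x. list_encode (L g x))"
  shows "effective_on C (\<lambda>g x. list_encode (drop (N g x) (L g x)))"
proof -
  have "effective_on C (\<lambda>g x. rec_nat (list_encode (L g x)) (\<lambda>_ r. snd_code (r - 1)) (N g x))"
    by (intro effective_intros assms)
  moreover have "rec_nat (list_encode l) (\<lambda>_ r. snd_code (r - 1)) n = list_encode (drop n l)" for l n
    by (induction n) (auto simp: list_encode_tl[symmetric] drop_Suc tl_drop simp del: One_nat_def)
  ultimately show ?thesis by simp
qed

lemma list_encode_eq_0: "list_encode l = 0 \<longleftrightarrow> l = []"
  by (cases l) auto

lemma effective_on_Nil_eq [effective_intros]:
  "effective_on C (\<lambda>g x. list_encode (L g x)) \<Longrightarrow> effective_on C (\<lambda>g x. of_bool (L g x = []))"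
  unfolding list_encode_eq_0[symmetric] by (intro effective_intros)

lemma effective_on_hd [effective_intros]:
  assumes "effective_on C (\<lambda>g x. list_encode (L g x))"
  shows "effective_on C (\<lambda>g x. hd (L g x))"
proof -
  \<comment> \<open>Although unspecified, \<open>hd []\<close> is some fixed number and can be
    hard-wired.\<close>
  have "effective_on C (\<lambda>g x. if L g x = [] then hd [] else fst_code (list_encode (L g x) - 1))"
    by (intro effective_intros assms)
  moreover have "(if l = [] then hd [] else fst_code (list_encode l - 1)) = hd l" for l :: "nat list"
    by (cases l) auto
  ultimately show ?thesis by simp
qed

lemma effective_on_list_comp:
  assumes "effective (\<lambda>g x. F g (list_decode x))" "effective_on C (\<lambda>g x. list_encode (L g x))"
  shows "effective_on C (\<lambda>g x. F g (L g x))"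
  using effective_comp[OF assms] by simp

lemma effective_on_length [effective_intros]:
  assumes "effective_on C (\<lambda>g x. list_encode (L g x))"
  shows "effective_on C (\<lambda>g x. length (L g x))"
proof -
  have ex: "\<exists>n. drop n l = []" for l :: "nat list" by (metis drop_all order_refl)
  have "effective (\<lambda>g x. LEAST n. drop n (list_decode x) = [])"
    by (intro effective_on_Least effective_intros ex)
  then have "effective_on C (\<lambda>g x. LEAST n. drop n (L g x) = [])"
    using assms by (rule effective_on_list_comp)
  moreover have "(LEAST n. drop n l = []) = length l" for l :: "nat list"
    by (rule Least_equality) auto
  ultimately show ?thesis by simp
qed

lemma effective_on_map_upt [effective_intros]:
  assumes "effective_on (\<lambda>g z. C g (fst_code z)) (\<lambda>g z. F g (fst_code z) (snd_code z))" "effective_on C N"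
  shows "effective_on C (\<lambda>g x. list_encode (map (F g x) [0..<N g x]))"
proof -
  have "effective_on (\<lambda>g z. C g (fst_code (snd_code z)))
      (\<lambda>g z. (\<lambda>g z. F g (fst_code z) (snd_code z)) g
        (prod_encode (fst_code (snd_code z), N g (fst_code (snd_code z)) - Suc (snd_code (snd_code z)))))"
    by (rule effective_on_comp[OF assms(1)])
      (auto intro!: effective_intros effective_on_comp[OF assms(2)])
  then have F: "effective_on (\<lambda>g z. C g (fst_code (snd_code z))) (\<lambda>g z. F g (fst_code (snd_code z))
        (N g (fst_code (snd_code z)) - Suc (snd_code (snd_code z))))"
    by simp
  have "effective_on C (\<lambda>g x. rec_nat 0 (\<lambda>m r. Suc (prod_encode (F g x (N g x - Suc m), r))) (N g x))"
    by (intro effective_intros assms F)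
  \<comment> \<open>List codes grow at the front, so the list is built from its last entry: after
    \<open>j\<close> steps the entries from \<open>n - j\<close> on are present.\<close>
  moreover have "rec_nat 0 (\<lambda>m r. Suc (prod_encode (h (n - Suc m), r))) j = list_encode (map h [n - j..<n])"
    if "j \<le> n" for h n j
    using that
  proof (induction j)
    case (Suc j)
    then have "[n - Suc j..<n] = (n - Suc j) # [n - j..<n]"
      by (simp add: upt_conv_Cons[of "n - Suc j"] Suc_diff_Suc)
    then show ?case using Suc by simp
  qed simp
  ultimately show ?thesis by simp
qed

lemma effective_on_pre [effective_intros]:
  "effective_on C N \<Longrightarrow> effective_on C (\<lambda>g x. list_encode (pre g (N g x)))"
  unfolding pre_def by (rule effective_on_map_upt) (intro effective_intros)

lemma effective_on_take [effective_intros]: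
  assumes "effective_on C N" "effective_on C (\<lambda>g x. list_encode (L g x))"
  shows "effective_on C (\<lambda>g x. list_encode (take (N g x) (L g x)))"
proof -
  \<comment> \<open>The range is capped at the length, so that \<open>hd\<close> is never applied to
    an exhausted list.\<close>
  let ?take = "\<lambda>n l. map (\<lambda>i. hd (drop i l)) [0..<if n \<le> length l then n else length l]"
  have take: "?take n l = take n l" for n and l :: "nat list"
    by (rule nth_equalityI) (auto simp: hd_drop_conv_nth split: if_splits)
  have "effective (\<lambda>g z. list_encode (?take (fst_code z) (list_decode (snd_code z))))"
    by (intro effective_intros)
  then have "effective (\<lambda>g z. list_encode (take (fst_code z) (list_decode (snd_code z))))"
    by (simp only: take)
  from effective_comp[OF this effective_on_pair[OF assms]] show ?thesis by simp
qed

text \<open>Replaces the maximum by a scan through the prefixes in increasing length: it starts with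
  the default value, and each prefix on which the program halts in time overrides the answer found
  so far.\<close>

lemma learner_rec:
  "learner e \<sigma> = rec_nat (fst_code e)
     (\<lambda>n r. if option_code (run (length \<sigma>) (\<lambda>_. 0) (snd_code e) (list_encode (take n \<sigma>))) = 0 then r
       else option_code (run (length \<sigma>) (\<lambda>_. 0) (snd_code e) (list_encode (take n \<sigma>))) - 1)
     (Suc (length \<sigma>))"
proof -
  define v where "v n = run (length \<sigma>) (\<lambda>_. 0) (snd_code e) (list_encode (take n \<sigma>))" for n
  define H where "H k = {n. n < k \<and> v n \<noteq> None}" for k
  have "rec_nat (fst_code e) (\<lambda>n r. if option_code (v n) = 0 then r else option_code (v n) - 1) k =
    (if H k = {} then fst_code e else the (v (Max (H k))))" for k
  proof (induction k)
    case (Suc k)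
    show ?case
    proof (cases "v k")
      case None
      then have "H (Suc k) = H k" by (auto simp: H_def less_Suc_eq)
      then show ?thesis using Suc None by simp
    next
      case (Some y)
      then have "k \<in> H (Suc k)" by (simp add: H_def)
      moreover from this have "Max (H (Suc k)) = k" by (intro Max_eqI) (auto simp: H_def)
      ultimately show ?thesis using Some by auto
    qed
  qed (simp add: H_def)
  from this[of "Suc (length \<sigma>)"] show ?thesis
    unfolding learner_def Let_def v_def H_def case_prod_beta less_Suc_eq_le by simp
qed

lemma effective_on_learner [effective_intros]:
  assumes "effective_on C (\<lambda>g x. list_encode (L g x))"
  shows "effective_on C (\<lambda>g x. learner e (L g x))"
proof (rule effective_on_list_comp[OF _ assms])
  show "effective (\<lambda>g x. learner e (list_decode x))"
    unfolding learner_rec by (intro effective_intros)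
qed


section \<open>Prefixes, functionals and index segments\<close>

lemma length_pre [simp]: "length (pre f n) = n"
  by (simp add: pre_def)

lemma take_pre [simp]: "m \<le> n \<Longrightarrow> take m (pre f n) = pre f m"
  by (simp add: pre_def take_map)

lemma pre_0 [simp]: "pre f 0 = []"
  by (simp add: pre_def)

lemma pre_case_nat_Suc [simp]: "pre (case_nat i f) (Suc n) = i # pre f n"
  by (simp add: pre_def upt_conv_Cons map_Suc_upt[symmetric] comp_def del: upt_Suc)

lemma the_computes: "computes g e n y \<Longrightarrow> (THE y. computes g e n y) = y"
  by (rule the_equality) (auto dest: computes_fun)

lemma Phi_eq_SomeI: "(\<And>n. computes g e n (h n)) \<Longrightarrow> Phi e g = Some h"
  unfolding Phi_def by (auto simp: the_computes)

lemma Phi_eq_SomeD: "Phi e g = Some h \<Longrightarrow> computes g e n (h n)"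
  unfolding Phi_def by (metis option.distinct(1) option.inject the_computes)

lemma segment_simps [simp]: "segment (enat k) = {..<k}" "segment \<infinity> = UNIV"
  by (auto simp: segment_def)

lemma segment_downward: "i \<in> segment X \<Longrightarrow> j \<le> i \<Longrightarrow> j \<in> segment X"
  unfolding segment_def by (auto intro: le_less_trans[of "enat j" "enat i"])

lemma effective_on_segment [effective_intros]:
  assumes "effective_on C F"
  shows "effective_on C (\<lambda>g x. of_bool (F g x \<in> segment X))"
proof (cases X)
  case (enat k)
  then show ?thesis by (simp add: lessThan_iff) (intro effective_intros assms)
next
  case infinity
  then show ?thesis by simp (rule effective_on_const)
qed

subsection \<open>Uniform families\<close>

definition decidable :: "(nat \<Rightarrow> nat list \<Rightarrow> bool) \<Rightarrow> bool" where
  "decidable P \<longleftrightarrow> computable (\<lambda>x. of_bool (P (fst_code x) (list_decode (snd_code x))))"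

definition decidable2 :: "(nat \<Rightarrow> nat \<Rightarrow> nat list \<Rightarrow> bool) \<Rightarrow> bool" where
  "decidable2 P \<longleftrightarrow> computable (\<lambda>x. of_bool
     (P (fst_code x) (fst_code (snd_code x)) (list_decode (snd_code (snd_code x)))))"

lemma effective_on_decidable:
  assumes "decidable P" "effective_on C F" "effective_on C (\<lambda>g x. list_encode (L g x))"
  shows "effective_on C (\<lambda>g x. of_bool (P (F g x) (L g x)))"
  using computable_effective_on[OF assms(1)[unfolded decidable_def] effective_on_pair[OF assms(2,3)]]
  by simp

lemma effective_on_decidable2:
  assumes "decidable2 P" "effective_on C M" "effective_on C F" "effective_on C (\<lambda>g x. list_encode (L g x))"
  shows "effective_on C (\<lambda>g x. of_bool (P (M g x) (F g x) (L g x)))"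
  using computable_effective_on[OF assms(1)[unfolded decidable2_def]
      effective_on_pair[OF assms(2) effective_on_pair[OF assms(3,4)]]]
  by simp

lemma effective_on_computable_list:
  assumes "computable (\<lambda>u. F (list_decode u))" "effective_on C (\<lambda>g x. list_encode (L g x))"
  shows "effective_on C (\<lambda>g x. F (L g x))"
  using computable_effective_on[OF assms] by simp

lemma decidableI:
  "effective (\<lambda>g x. of_bool (P (fst_code x) (list_decode (snd_code x)))) \<Longrightarrow> decidable P"
  unfolding decidable_def by (rule effective_computable)

lemma decidable2I:
  "effective (\<lambda>g x. of_bool (P (fst_code x) (fst_code (snd_code x)) (list_decode (snd_code (snd_code x)))))
    \<Longrightarrow> decidable2 P"
  unfolding decidable2_def by (rule effective_computable)

lemma Sigma02_iff:
  "A \<in> Sigma02 \<longleftrightarrow> (\<exists>R. decidable R \<and> A = {f. \<exists>m. \<forall>n. R m (pre f n)})"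
  unfolding Sigma02_def decidable_def case_prod_beta by blast

text \<open>A pair has the prefixes \<open>[]\<close> and \<open>i # pre f n\<close>. The empty one
  carries no index and contributes a conjunct independent of \<open>i\<close> and
  \<open>f\<close>.\<close>

lemma all_pre_case_nat:
  "(\<forall>n. R (pre (case_nat i f) n)) \<longleftrightarrow> (\<forall>n. R [] \<and> R (i # pre f n))"
proof -
  have "(\<forall>n. Q n) \<longleftrightarrow> Q 0 \<and> (\<forall>n. Q (Suc n))" for Q by (metis not0_implies_Suc)
  from this[of "\<lambda>n. R (pre (case_nat i f) n)"] show ?thesis by simp
qed

lemma case_nat_mem_iff: "case_nat i f \<in> {case_nat i f |i f. i \<in> I \<and> f \<in> S i} \<longleftrightarrow> i \<in> I \<and> f \<in> S i"
proof -
  have "i = j" "f = h" if eq: "case_nat i f = case_nat j h" for j h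
  proof -
    show "i = j" using fun_cong[OF eq, of 0] by simp
    show "f = h"
    proof
      show "f n = h n" for n using fun_cong[OF eq, of "Suc n"] by simp
    qed
  qed
  then show ?thesis by blast
qed

lemma case_nat_set_eqI:
  assumes "\<And>i f. case_nat i f \<in> A \<longleftrightarrow> case_nat i f \<in> B"
  shows "A = (B :: baire set)"
proof (rule set_eqI)
  fix h :: baire
  have "h = case_nat (h 0) (\<lambda>n. h (Suc n))"
    by (auto simp: fun_eq_iff split: nat.splits)
  then show "h \<in> A \<longleftrightarrow> h \<in> B" using assms by metis
qed

lemma uniformly_Pi01D:
  assumes "uniformly Pi01 I S"
  shows "\<exists>P. decidable P \<and> (\<forall>i\<in>I. S i = {f. \<forall>n. P i (pre f n)})"
proof -
  obtain R where R: "computable (\<lambda>u. of_bool (R (list_decode u)))"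
    and eq: "{case_nat i f |i f. i \<in> I \<and> f \<in> S i} = {f. \<forall>n. R (pre f n)}"
    using assms unfolding uniformly_def Pi01_def by blast
  show ?thesis
  proof (intro exI[of _ "\<lambda>i \<sigma>. R [] \<and> R (i # \<sigma>)"] conjI ballI)
    show "decidable (\<lambda>i \<sigma>. R [] \<and> R (i # \<sigma>))"
      by (intro decidableI effective_intros
        effective_on_computable_list[of "\<lambda>\<sigma>. of_bool (R \<sigma>)", OF R])
    show "S i = {f. \<forall>n. R [] \<and> R (i # pre f n)}" if "i \<in> I" for i
      unfolding all_pre_case_nat[symmetric] using that case_nat_mem_iff[of i _ I S] unfolding eq by auto
  qed
qed

lemma uniformly_Pi01I:
  assumes "decidable P"
  shows "uniformly Pi01 (segment X) (\<lambda>i. {f. \<forall>n. P i (pre f n)})"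
proof -
  \<comment> \<open>The empty string passes because it does not show the index yet. The range of the
    index is tested as well, since pairs with an index outside the segment must be excluded.\<close>
  let ?R = "\<lambda>\<sigma>. \<sigma> = [] \<or> hd \<sigma> \<in> segment X \<and> P (hd \<sigma>) (tl \<sigma>)"
  have "computable (\<lambda>u. of_bool (?R (list_decode u)))"
    by (intro effective_computable effective_intros effective_on_decidable[OF assms])
  moreover have R: "(\<forall>n. ?R (pre (case_nat i f) n)) \<longleftrightarrow> i \<in> segment X \<and> (\<forall>n. P i (pre f n))" for i f
    unfolding all_pre_case_nat[of ?R i f] by simp
  have "{case_nat i f |i f. i \<in> segment X \<and> f \<in> {f. \<forall>n. P i (pre f n)}} = {f. \<forall>n. ?R (pre f n)}"
    by (rule case_nat_set_eqI, unfold case_nat_mem_iff) (simp only: mem_Collect_eq R)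
  ultimately show ?thesis unfolding uniformly_def Pi01_def mem_Collect_eq by (intro exI[of _ ?R] conjI)
qed

lemma uniformly_Sigma02D:
  assumes "uniformly Sigma02 I S"
  shows "\<exists>P. decidable2 P \<and> (\<forall>i\<in>I. S i = {f. \<exists>m. \<forall>n. P m i (pre f n)})"
proof -
  obtain R where R: "decidable R"
    and eq: "{case_nat i f |i f. i \<in> I \<and> f \<in> S i} = {f. \<exists>m. \<forall>n. R m (pre f n)}"
    using assms unfolding uniformly_def Sigma02_iff by blast
  show ?thesis
  proof (intro exI[of _ "\<lambda>m i \<sigma>. R m [] \<and> R m (i # \<sigma>)"] conjI ballI)
    show "decidable2 (\<lambda>m i \<sigma>. R m [] \<and> R m (i # \<sigma>))"
      by (intro decidable2I effective_intros effective_on_decidable[OF R])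
    show "S i = {f. \<exists>m. \<forall>n. R m [] \<and> R m (i # pre f n)}" if "i \<in> I" for i
      unfolding all_pre_case_nat[symmetric] using that case_nat_mem_iff[of i _ I S] unfolding eq by auto
  qed
qed

lemma uniformly_Sigma02I:
  assumes "decidable2 P"
  shows "uniformly Sigma02 (segment X) (\<lambda>i. {f. \<exists>m. \<forall>n. P m i (pre f n)})"
proof -
  let ?R = "\<lambda>m \<sigma>. \<sigma> = [] \<or> hd \<sigma> \<in> segment X \<and> P m (hd \<sigma>) (tl \<sigma>)"
  have "decidable ?R"
    by (intro decidableI effective_intros effective_on_decidable2[OF assms])
  moreover have R: "(\<forall>n. ?R m (pre (case_nat i f) n)) \<longleftrightarrow> i \<in> segment X \<and> (\<forall>n. P m i (pre f n))" for m i f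
    unfolding all_pre_case_nat[of "?R m" i f] by simp
  have "{case_nat i f |i f. i \<in> segment X \<and> f \<in> {f. \<exists>m. \<forall>n. P m i (pre f n)}} =
      {f. \<exists>m. \<forall>n. ?R m (pre f n)}"
    by (rule case_nat_set_eqI, unfold case_nat_mem_iff) (simp only: mem_Collect_eq R, blast)
  ultimately show ?thesis unfolding uniformly_def Sigma02_iff by (intro exI[of _ ?R] conjI)
qed

lemma uniformly_Pi02D:
  assumes "uniformly Pi02 I S"
  shows "\<exists>P. decidable2 P \<and> (\<forall>i\<in>I. S i = {f. \<forall>m. \<exists>n. \<not> P m i (pre f n)})"
proof -
  obtain R where R: "decidable R"
    and "- {case_nat i f |i f. i \<in> I \<and> f \<in> S i} = {f. \<exists>m. \<forall>n. R m (pre f n)}"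
    using assms unfolding uniformly_def Pi02_def mem_Collect_eq Sigma02_iff by blast
  then have eq: "{case_nat i f |i f. i \<in> I \<and> f \<in> S i} = - {f. \<exists>m. \<forall>n. R m (pre f n)}" by blast
  show ?thesis
  proof (intro exI[of _ "\<lambda>m i \<sigma>. R m [] \<and> R m (i # \<sigma>)"] conjI ballI)
    show "decidable2 (\<lambda>m i \<sigma>. R m [] \<and> R m (i # \<sigma>))"
      by (intro decidable2I effective_intros effective_on_decidable[OF R])
    show "S i = {f. \<forall>m. \<exists>n. \<not> (R m [] \<and> R m (i # pre f n))}" if "i \<in> I" for i
      unfolding not_all[symmetric] all_pre_case_nat[symmetric]
      using that case_nat_mem_iff[of i _ I S] unfolding eq by auto
  qed
qed

lemma uniformly_Pi02I:
  assumes "decidable2 P"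
  shows "uniformly Pi02 (segment X) (\<lambda>i. {f. \<forall>m. \<exists>n. \<not> P m i (pre f n)})"
proof -
  \<comment> \<open>This describes the complement, so the range test is reversed: pairs with an
    index outside the segment belong to it.\<close>
  let ?R = "\<lambda>m \<sigma>. \<sigma> = [] \<or> hd \<sigma> \<notin> segment X \<or> P m (hd \<sigma>) (tl \<sigma>)"
  have "decidable ?R"
    by (intro decidableI effective_intros effective_on_decidable2[OF assms])
  moreover have R: "(\<forall>n. ?R m (pre (case_nat i f) n)) \<longleftrightarrow> i \<notin> segment X \<or> (\<forall>n. P m i (pre f n))" for m i f
    unfolding all_pre_case_nat[of "?R m" i f] by auto
  have "- {case_nat i f |i f. i \<in> segment X \<and> f \<in> {f. \<forall>m. \<exists>n. \<not> P m i (pre f n)}} =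
      {f. \<exists>m. \<forall>n. ?R m (pre f n)}"
    by (rule case_nat_set_eqI, unfold Compl_iff case_nat_mem_iff) (simp only: mem_Collect_eq R, blast)
  ultimately show ?thesis unfolding uniformly_def Pi02_def mem_Collect_eq Sigma02_iff
    by (intro exI[of _ ?R] conjI)
qed

lemma Pi01_subset_Delta02: "Pi01 \<subseteq> Delta02"
proof
  fix A assume "A \<in> Pi01"
  then obtain R where R: "computable (\<lambda>u. of_bool (R (list_decode u)))" and A: "A = {f. \<forall>n. R (pre f n)}"
    unfolding Pi01_def by blast
  note R = effective_on_computable_list[of "\<lambda>\<sigma>. of_bool (R \<sigma>)", OF R]
  have "decidable (\<lambda>m. R)" by (intro decidableI effective_intros R)
  then have "A \<in> Sigma02" unfolding Sigma02_iff A by auto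
  \<comment> \<open>The witness \<open>m\<close> is the length of a prefix that violates
    \<open>R\<close>; shorter prefixes cannot show this yet and pass vacuously.\<close>
  moreover have dec: "decidable (\<lambda>m \<sigma>. m \<le> length \<sigma> \<longrightarrow> \<not> R (take m \<sigma>))"
    by (intro decidableI effective_intros R)
  have "- A = {f. \<exists>m. \<forall>n. m \<le> length (pre f n) \<longrightarrow> \<not> R (take m (pre f n))}"
    unfolding A by auto
  then have "- A \<in> Sigma02" unfolding Sigma02_iff using dec by blast
  ultimately show "A \<in> Delta02" unfolding Delta02_def Pi02_def by blast
qed

section \<open>Shapes of decompositions\<close>

lemma uniformly_mono: "\<Lambda> \<subseteq> \<Lambda>' \<Longrightarrow> uniformly \<Lambda> I S \<Longrightarrow> uniformly \<Lambda>' I S"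
  unfolding uniformly_def by blast

lemma decomposition_mono: "\<Lambda> \<subseteq> \<Lambda>' \<Longrightarrow> decomposition x \<Lambda> I Q R \<Longrightarrow> decomposition x \<Lambda>' I Q R"
  using uniformly_mono[of \<Lambda> \<Lambda>' I]
  by (cases x) (simp_all add: uniform_partition_def uniform_cover_def uniform_layer_def, blast+)

lemma dec_mono: "\<Lambda> \<subseteq> \<Lambda>' \<Longrightarrow> dec x X \<Lambda> \<subseteq> dec x X \<Lambda>'"
  unfolding dec_def using decomposition_mono by blast

text \<open>The fibres of one function \<open>L\<close> serve all three shapes at once: partitions
  and covers need the condition \<open>L g = i\<close> to be definable, layers need
  \<open>L g \<le> i\<close>. Both definitions have to be right only on \<open>Q\<close>.\<close>

lemma decomposition_rankI:
  assumes "\<And>g. g \<in> Q \<Longrightarrow> L g \<in> segment X"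
    and "uniformly \<Lambda> (segment X) S" "\<And>g i. g \<in> Q \<Longrightarrow> g \<in> S i \<longleftrightarrow> L g = i"
    and "uniformly \<Lambda> (segment X) T" "\<And>g i. g \<in> Q \<Longrightarrow> g \<in> T i \<longleftrightarrow> L g \<le> i" "\<And>i. T i \<subseteq> T (Suc i)"
  shows "decomposition x \<Lambda> (segment X) Q (\<lambda>i. {g \<in> Q. L g = i})"
proof -
  have "uniform_cover \<Lambda> (segment X) Q (\<lambda>i. {g \<in> Q. L g = i})"
    unfolding uniform_cover_def
  proof (intro exI[of _ S] conjI ballI)
    show "(\<Union>i\<in>segment X. {g \<in> Q. L g = i}) = Q" using assms(1) by auto
  qed (use assms(2,3) in auto)
  moreover have "disjoint_family_on (\<lambda>i. {g \<in> Q. L g = i}) (segment X)"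
    by (auto simp: disjoint_family_on_def)
  moreover have "uniform_layer \<Lambda> (segment X) Q (\<lambda>i. {g \<in> Q. L g = i})"
    unfolding uniform_layer_def
  proof (intro exI[of _ T] conjI ballI)
    show "Q \<subseteq> (\<Union>i\<in>segment X. T i)"
    proof
      fix g assume "g \<in> Q"
      then show "g \<in> (\<Union>i\<in>segment X. T i)" using assms(1)[of g] assms(5)[of g "L g"] by blast
    qed
    show "\<forall>i. Suc i \<in> segment X \<longrightarrow> T i \<subseteq> T (Suc i)" by (intro allI impI assms(6))
    show "{g \<in> Q. L g = i} = Q \<inter> (T i - (case i of 0 \<Rightarrow> {} | Suc j \<Rightarrow> T j))" for i
      using assms(5) by (auto split: nat.splits)
  qed (rule assms(4))
  ultimately show ?thesis by (cases x) (auto simp: uniform_partition_def)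
qed

lemma decomposition_UNIV:
  assumes "\<And>g. g \<in> Q \<Longrightarrow> L g \<in> segment X"
  shows "decomposition x UNIV (segment X) Q (\<lambda>i. {g \<in> Q. L g = i})"
  by (rule decomposition_rankI[OF assms, where S = "\<lambda>i. {g. L g = i}" and T = "\<lambda>i. {g. L g \<le> i}"])
    (auto simp: uniformly_def)

text \<open>The pieces determine the cumulative sets on \<open>Q\<close>. Hence two families that
  cut out the same layers agree there, whatever they do outside.\<close>

lemma layer_cumulative:
  assumes "\<forall>i. Suc i \<in> segment X \<longrightarrow> S i \<subseteq> S (Suc i)"
    and "\<forall>i \<in> segment X. R i = Q \<inter> (S i - (case i of 0 \<Rightarrow> {} | Suc j \<Rightarrow> S j))" and "i \<in> segment X"
  shows "Q \<inter> S i = (\<Union>j\<le>i. R j)"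
  using assms(3)
proof (induction i)
  case 0
  then show ?case using assms(2) by auto
next
  case (Suc i)
  have i: "i \<in> segment X" using Suc.prems by (rule segment_downward) simp
  have "R (Suc i) = Q \<inter> (S (Suc i) - S i)" using assms(2) Suc.prems by auto
  moreover have "S i \<subseteq> S (Suc i)" using assms(1) Suc.prems by blast
  ultimately have "Q \<inter> S (Suc i) = Q \<inter> S i \<union> R (Suc i)" by blast
  then show ?case using Suc.IH[OF i] by (simp add: atMost_Suc Un_commute)
qed

lemma decomposition_cover:
  assumes "decomposition x \<Lambda> (segment X) Q R"
  shows "(\<Union>i\<in>segment X. R i) = Q"
proof (cases x)
  case Layer
  then obtain S where S: "\<forall>i. Suc i \<in> segment X \<longrightarrow> S i \<subseteq> S (Suc i)" "Q \<subseteq> (\<Union>i\<in>segment X. S i)"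
    "\<forall>i \<in> segment X. R i = Q \<inter> (S i - (case i of 0 \<Rightarrow> {} | Suc j \<Rightarrow> S j))"
    using assms by (auto simp: uniform_layer_def)
  have "g \<in> (\<Union>i\<in>segment X. R i)" if "g \<in> Q" for g
  proof -
    obtain i where i: "i \<in> segment X" "g \<in> S i" using S(2) \<open>g \<in> Q\<close> by blast
    then obtain j where "j \<le> i" "g \<in> R j" using layer_cumulative[OF S(1,3) i(1)] \<open>g \<in> Q\<close> by blast
    then show ?thesis using segment_downward[OF i(1)] by blast
  qed
  then show ?thesis using S(3) by blast
qed (use assms in \<open>auto simp: uniform_partition_def uniform_cover_def\<close>)

section \<open>Decompositions that are Delta-0-2 relative to the domain\<close>

lemma dec_Delta02_subset: "dec x X Delta02 \<subseteq> dec_relDelta02 x X"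
proof -
  have "Delta02 \<subseteq> Sigma02" "Delta02 \<subseteq> Pi02" by (auto simp: Delta02_def)
  then show ?thesis unfolding dec_def dec_relDelta02_def using decomposition_mono by blast
qed

lemma ex_pair_code: "(\<exists>m. Q (fst_code m) \<and> Q' (snd_code m)) \<longleftrightarrow> (\<exists>m. Q m) \<and> (\<exists>m. Q' m)"
proof
  assume "(\<exists>m. Q m) \<and> (\<exists>m. Q' m)"
  then obtain a b where "Q a" "Q' b" by blast
  then show "\<exists>m. Q (fst_code m) \<and> Q' (snd_code m)" by (intro exI[of _ "prod_encode (a, b)"]) simp
qed blast

text \<open>Only layers require an argument, because a layer is a difference of two Sigma-0-2 sets.
  On the domain the removed set \<open>S j\<close> agrees with the Pi-0-2 set \<open>T j\<close>;
  removing the latter instead leaves a Sigma-0-2 set.\<close>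

lemma dec_relDelta02_subset: "dec_relDelta02 x X \<subseteq> dec Cover X Sigma02"
proof
  fix \<Gamma> assume "\<Gamma> \<in> dec_relDelta02 x X"
  then obtain R where \<Sigma>: "decomposition x Sigma02 (segment X) (dom \<Gamma>) R"
    and \<Pi>: "decomposition x Pi02 (segment X) (dom \<Gamma>) R" and pw: "piecewise (segment X) R \<Gamma>"
    unfolding dec_relDelta02_def by blast
  have "uniform_cover Sigma02 (segment X) (dom \<Gamma>) R"
  proof (cases x)
    case Layer
    obtain S where S: "uniformly Sigma02 (segment X) S" "\<forall>i. Suc i \<in> segment X \<longrightarrow> S i \<subseteq> S (Suc i)"
      "\<forall>i \<in> segment X. R i = dom \<Gamma> \<inter> (S i - (case i of 0 \<Rightarrow> {} | Suc j \<Rightarrow> S j))"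
      using \<Sigma> unfolding Layer decomposition.simps uniform_layer_def by blast
    obtain T where T: "uniformly Pi02 (segment X) T" "\<forall>i. Suc i \<in> segment X \<longrightarrow> T i \<subseteq> T (Suc i)"
      "\<forall>i \<in> segment X. R i = dom \<Gamma> \<inter> (T i - (case i of 0 \<Rightarrow> {} | Suc j \<Rightarrow> T j))"
      using \<Pi> unfolding Layer decomposition.simps uniform_layer_def by blast
    obtain P where P: "decidable2 P" "\<forall>i\<in>segment X. S i = {f. \<exists>m. \<forall>n. P m i (pre f n)}"
      using uniformly_Sigma02D[OF S(1)] by blast
    obtain P' where P': "decidable2 P'" "\<forall>i\<in>segment X. T i = {f. \<forall>m. \<exists>n. \<not> P' m i (pre f n)}"
      using uniformly_Pi02D[OF T(1)] by blast
    \<comment> \<open>\<open>m\<close> codes two witnesses, one for membership in \<open>S i\<close>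
      and one against membership in \<open>T (i - 1)\<close>; nothing is removed from the layer
      0.\<close>
    let ?U = "\<lambda>i. {f. \<exists>m. \<forall>n. P (fst_code m) i (pre f n) \<and> (i = 0 \<or> P' (snd_code m) (i - 1) (pre f n))}"
    have "decidable2 (\<lambda>m i \<sigma>. P (fst_code m) i \<sigma> \<and> (i = 0 \<or> P' (snd_code m) (i - 1) \<sigma>))"
      by (intro decidable2I effective_intros effective_on_decidable2[OF P(1)] effective_on_decidable2[OF P'(1)])
    then have "uniformly Sigma02 (segment X) ?U" by (rule uniformly_Sigma02I)
    moreover have "R i = dom \<Gamma> \<inter> ?U i" if i: "i \<in> segment X" for i
    proof (cases i)
      case 0
      have "f \<in> ?U i \<longleftrightarrow> (\<exists>m. \<forall>n. P m i (pre f n))" for f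
        using ex_pair_code[of "\<lambda>m. \<forall>n. P m i (pre f n)" "\<lambda>_. True"] by (simp add: 0)
      moreover have "f \<in> S i \<longleftrightarrow> (\<exists>m. \<forall>n. P m i (pre f n))" for f
        unfolding P(2)[rule_format, OF i] by simp
      ultimately have "?U i = S i" by (intro set_eqI) (simp only:)
      moreover have "R i = dom \<Gamma> \<inter> S i" using S(3) i 0 by auto
      ultimately show ?thesis by simp
    next
      case (Suc j)
      have j: "j \<in> segment X" using i by (rule segment_downward) (simp add: Suc)
      have "f \<in> ?U i \<longleftrightarrow> (\<exists>m. \<forall>n. P m i (pre f n)) \<and> (\<exists>m. \<forall>n. P' m j (pre f n))" for f
        unfolding ex_pair_code[of "\<lambda>m. \<forall>n. P m i (pre f n)" "\<lambda>m. \<forall>n. P' m j (pre f n)", symmetric]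
        by (simp add: Suc all_conj_distrib)
      moreover have "f \<in> S i - T j \<longleftrightarrow> (\<exists>m. \<forall>n. P m i (pre f n)) \<and> (\<exists>m. \<forall>n. P' m j (pre f n))" for f
        unfolding P(2)[rule_format, OF i] P'(2)[rule_format, OF j] by simp
      ultimately have "?U i = S i - T j" by (intro set_eqI) (simp only:)
      moreover have "dom \<Gamma> \<inter> S j = dom \<Gamma> \<inter> T j"
        using layer_cumulative[OF S(2,3) j] layer_cumulative[OF T(2,3) j] by simp
      then have "dom \<Gamma> \<inter> (S i - S j) = dom \<Gamma> \<inter> (S i - T j)" by blast
      moreover have "R i = dom \<Gamma> \<inter> (S i - S j)" using S(3) i Suc by auto
      ultimately show ?thesis by (simp only:)
    qed
    ultimately show ?thesis unfolding uniform_cover_def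
      by (intro conjI exI[of _ ?U] ballI decomposition_cover[OF \<Sigma>])
  qed (use \<Sigma> in \<open>auto simp: uniform_partition_def\<close>)
  then show "\<Gamma> \<in> dec Cover X Sigma02" unfolding dec_def mem_Collect_eq decomposition.simps
    using pw by (intro exI[of _ R] conjI)
qed


subsection \<open>Learning with bounded resources\<close>

definition learns :: "(nat list \<Rightarrow> nat) \<Rightarrow> enat \<Rightarrow> enat \<Rightarrow> (baire \<rightharpoonup> baire) \<Rightarrow> baire \<Rightarrow> bool" where
  "learns \<Psi> \<beta> \<gamma> \<Gamma> g \<longleftrightarrow> (\<exists>p. (\<lambda>n. \<Psi> (pre g n)) \<longlonglongrightarrow> p \<and> Phi p g = \<Gamma> g) \<and>
     ecard (mcl \<Psi> g) < \<beta> \<and> ecard (indx \<Psi> g) \<le> \<gamma>"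

lemma CT_learns: "\<Gamma> \<in> CT \<alpha> \<beta> \<gamma> \<longleftrightarrow> (\<exists>I. ecard I = \<alpha> \<and> (\<forall>g \<in> dom \<Gamma>. \<exists>e \<in> I. learns (learner e) \<beta> \<gamma> \<Gamma> g))"
  by (simp add: CT_def learns_def)

lemma CT_infinity_iff: "\<Gamma> \<in> CT \<infinity> \<beta> \<gamma> \<longleftrightarrow> (\<forall>g \<in> dom \<Gamma>. \<exists>e. learns (learner e) \<beta> \<gamma> \<Gamma> g)"
proof
  assume "\<forall>g \<in> dom \<Gamma>. \<exists>e. learns (learner e) \<beta> \<gamma> \<Gamma> g"
  then have "ecard (UNIV :: nat set) = \<infinity> \<and> (\<forall>g \<in> dom \<Gamma>. \<exists>e \<in> UNIV. learns (learner e) \<beta> \<gamma> \<Gamma> g)"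
    by (simp add: ecard_def)
  then show "\<Gamma> \<in> CT \<infinity> \<beta> \<gamma>" unfolding CT_learns by (rule exI)
qed (unfold CT_learns, blast)

lemma CT_enat_iff: "\<Gamma> \<in> CT (enat k) \<beta> \<gamma> \<longleftrightarrow> (\<exists>E. \<forall>g \<in> dom \<Gamma>. \<exists>i<k. learns (learner (E i)) \<beta> \<gamma> \<Gamma> g)"
proof
  assume "\<Gamma> \<in> CT (enat k) \<beta> \<gamma>"
  then obtain I :: "nat set" where "ecard I = enat k" and I: "\<forall>g \<in> dom \<Gamma>. \<exists>e \<in> I. learns (learner e) \<beta> \<gamma> \<Gamma> g"
    unfolding CT_learns by blast
  then have "finite I" "card I = k" by (auto simp: ecard_def split: if_splits)
  then obtain E where "bij_betw E {..<k} I"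
    using ex_bij_betw_nat_finite[of I] by (auto simp: atLeast0LessThan)
  then have "I = E ` {..<k}" by (simp add: bij_betw_def)
  then show "\<exists>E. \<forall>g \<in> dom \<Gamma>. \<exists>i<k. learns (learner (E i)) \<beta> \<gamma> \<Gamma> g" using I
    by (intro exI[of _ E]) auto
next
  assume "\<exists>E. \<forall>g \<in> dom \<Gamma>. \<exists>i<k. learns (learner (E i)) \<beta> \<gamma> \<Gamma> g"
  then obtain E where E: "\<forall>g \<in> dom \<Gamma>. \<exists>i<k. learns (learner (E i)) \<beta> \<gamma> \<Gamma> g" by blast
  let ?I = "E ` {..<k}"
  have card: "card ?I \<le> k" using card_image_le[of "{..<k}" E] by simp
  \<comment> \<open>The index set must have exactly \<open>k\<close> elements, but \<open>E\<close>
    may repeat values. Fresh indices fill it up; they do no harm since only one successful learner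
    is asked for.\<close>
  have "infinite (UNIV - ?I)" by (intro Diff_infinite_finite) auto
  then obtain J where J: "J \<subseteq> UNIV - ?I" "finite J" "card J = k - card ?I"
    using infinite_arbitrarily_large[of "UNIV - ?I" "k - card ?I"] by blast
  then have "card (?I \<union> J) = k" using card by (subst card_Un_disjoint) auto
  then have "ecard (?I \<union> J) = enat k" using J(2) by (simp add: ecard_def)
  moreover have "\<forall>g \<in> dom \<Gamma>. \<exists>e \<in> ?I \<union> J. learns (learner e) \<beta> \<gamma> \<Gamma> g" using E by blast
  ultimately show "\<Gamma> \<in> CT (enat k) \<beta> \<gamma>" unfolding CT_learns by blast
qed

lemma CT_1_iff: "\<Gamma> \<in> CT 1 \<beta> \<gamma> \<longleftrightarrow> (\<exists>e. \<forall>g \<in> dom \<Gamma>. learns (learner e) \<beta> \<gamma> \<Gamma> g)"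
proof -
  have "\<Gamma> \<in> CT 1 \<beta> \<gamma> \<longleftrightarrow> (\<exists>E. \<forall>g \<in> dom \<Gamma>. learns (learner (E (0 :: nat))) \<beta> \<gamma> \<Gamma> g)"
    unfolding one_enat_def CT_enat_iff by simp
  then show ?thesis using exI[of "\<lambda>E. \<forall>g \<in> dom \<Gamma>. learns (learner (E 0)) \<beta> \<gamma> \<Gamma> g" "\<lambda>_ :: nat. _"] by blast
qed

lemma ecard_mono: "A \<subseteq> B \<Longrightarrow> ecard A \<le> ecard B"
  by (auto simp: ecard_def card_mono dest: finite_subset)

text \<open>Learners can now be written as computable functions on strings. The enumerated learner
  follows \<open>\<Psi>\<close> with a delay, starting from \<open>\<Psi> []\<close>, and so gains
  neither values nor mind changes.\<close>

lemma total_learner_learns: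
  assumes "computable (\<lambda>u. \<Psi> (list_decode u))"
  shows "\<exists>e. \<forall>\<beta> \<gamma> \<Gamma> g. learns \<Psi> \<beta> \<gamma> \<Gamma> g \<longrightarrow> learns (learner e) \<beta> \<gamma> \<Gamma> g"
proof -
  obtain p where "\<And>x. computes (\<lambda>_. 0) p x (\<Psi> (list_decode x))"
    using assms unfolding computable_def by blast
  then have "computes (\<lambda>_. 0) p (list_encode \<sigma>) (\<Psi> \<sigma>)" for \<sigma> by (metis list_encode_inverse)
  note dom = learner_dominates_total[of p \<Psi>, OF this]
  have "learns (learner (prod_encode (\<Psi> [], p))) \<beta> \<gamma> \<Gamma> g" if "learns \<Psi> \<beta> \<gamma> \<Gamma> g" for \<beta> \<gamma> \<Gamma> g
    unfolding learns_def
  proof (intro conjI)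
    show "\<exists>q. (\<lambda>n. learner (prod_encode (\<Psi> [], p)) (pre g n)) \<longlonglongrightarrow> q \<and> Phi q g = \<Gamma> g"
      using that dom(1)[of g] unfolding learns_def by blast
    show "ecard (mcl (learner (prod_encode (\<Psi> [], p))) g) < \<beta>"
      using that dom(3)[of g] unfolding learns_def by (auto intro: le_less_trans)
    show "ecard (indx (learner (prod_encode (\<Psi> [], p))) g) \<le> \<gamma>"
      using that ecard_mono[OF dom(2)[of g]] unfolding learns_def by (auto intro: order_trans)
  qed
  then show ?thesis by blast
qed

lemma constant_learner: "\<exists>e. \<forall>\<Gamma> g. Phi c g = \<Gamma> g \<longrightarrow> learns (learner e) 1 \<infinity> \<Gamma> g"
proof -
  have "computable (\<lambda>u. c)" by (intro effective_computable effective_intros)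
  moreover have "learns (\<lambda>_. c) 1 \<infinity> \<Gamma> g" if "Phi c g = \<Gamma> g" for \<Gamma> g
    using that by (auto simp: learns_def mcl_def ecard_def zero_enat_def[symmetric])
  ultimately show ?thesis using total_learner_learns[of "\<lambda>_. c"] by blast
qed

lemma learns_one:
  assumes "learns (learner e) 1 \<gamma> \<Gamma> g"
  shows "Phi (learner e []) g = \<Gamma> g"
proof -
  obtain p where p: "(\<lambda>n. learner e (pre g n)) \<longlonglongrightarrow> p" "Phi p g = \<Gamma> g"
    using assms unfolding learns_def by blast
  have "ecard (mcl (learner e) g) < 1" using assms by (simp add: learns_def)
  then have "mcl (learner e) g = {}" by (auto simp: ecard_def one_enat_def split: if_splits)
  then have "learner e (pre g n) = learner e []" for n by (induction n) (auto simp: mcl_def)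
  then have "(\<lambda>n. learner e []) \<longlonglongrightarrow> p" using p(1) by simp
  then have "learner e [] = p" by (simp add: LIMSEQ_const_iff)
  then show ?thesis using p(2) by simp
qed

lemma mcl_finite:
  fixes \<Psi> :: "nat list \<Rightarrow> nat"
  assumes "(\<lambda>n. \<Psi> (pre g n)) \<longlonglongrightarrow> p"
  shows "finite (mcl \<Psi> g)"
proof -
  obtain N where N: "\<And>n. n \<ge> N \<Longrightarrow> \<Psi> (pre g n) = p"
    using assms by (auto simp: tendsto_discrete eventually_sequentially)
  have "mcl \<Psi> g \<subseteq> {..<N}"
  proof
    fix n assume "n \<in> mcl \<Psi> g"
    then show "n \<in> {..<N}" using N[of n] N[of "n + 1"] by (cases "N \<le> n") (auto simp: mcl_def)
  qed
  then show ?thesis by (rule finite_subset) simp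
qed

text \<open>For finitely many pieces a computable index map is no restriction: every finite table
  extends to a computable function.\<close>

lemma finite_function_computable: "\<exists>e. computable e \<and> (\<forall>i<k. e i = c i)"
proof (induction k)
  case 0
  have "computable (\<lambda>_. 0)" by (intro effective_computable effective_intros)
  then show ?case by blast
next
  case (Suc k)
  then obtain e where e: "computable e" "\<forall>i<k. e i = c i" by blast
  have "computable (\<lambda>i. if i = k then c k else e i)"
    by (intro effective_computable effective_intros computable_effective_on[OF e(1)])
  moreover have "\<forall>i<Suc k. (if i = k then c k else e i) = c i" using e(2) by (auto simp: less_Suc_eq)
  ultimately show ?case by (intro exI[of _ "\<lambda>i. if i = k then c k else e i"] conjI)
qed

text \<open>\<open>W i \<sigma>\<close> is a decidable certificate that the hypothesis on
  \<open>\<sigma>\<close> is correct, provided that \<open>i\<close> is the number of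
  \<open>g\<close>. The program for piece \<open>i\<close> searches for a certified prefix of its
  oracle and runs the hypothesis found there.\<close>

lemma piecewise_searchI:
  assumes W: "decidable W"
    and ex: "\<And>g. g \<in> dom \<Gamma> \<Longrightarrow> \<exists>n. W (L g) (pre g n)"
    and Phi: "\<And>g n. g \<in> dom \<Gamma> \<Longrightarrow> W (L g) (pre g n) \<Longrightarrow> Phi (learner e (pre g n)) g = \<Gamma> g"
  shows "piecewise I (\<lambda>i. {g \<in> dom \<Gamma>. L g = i}) \<Gamma>"
proof -
  \<comment> \<open>Input \<open>z\<close> is the pair of the piece number and the argument. With a
    wrong number, or off the domain, the search may diverge or find a wrong hypothesis.\<close>
  let ?C = "\<lambda>g z. g \<in> dom \<Gamma> \<and> L g = fst_code z"
  have "effective_on ?C (\<lambda>g z. LEAST n. W (fst_code z) (pre g n))"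
    by (intro effective_on_Least effective_intros effective_on_decidable[OF W]) (metis ex)
  then have search: "effective_on ?C (\<lambda>g z. learner e (pre g (LEAST n. W (fst_code z) (pre g n))))"
    by (intro effective_intros)
  have "effective_on ?C (\<lambda>g z. the (\<Gamma> g) (snd_code z))"
  proof (rule effective_on_interp[OF search, where X = "\<lambda>g z. snd_code z"])
    fix g z assume C: "?C g z"
    then have g: "g \<in> dom \<Gamma>" and z: "fst_code z = L g" by simp_all
    have "W (L g) (pre g (LEAST n. W (fst_code z) (pre g n)))"
      unfolding z by (rule LeastI_ex[OF ex[OF g]])
    then have "Phi (learner e (pre g (LEAST n. W (fst_code z) (pre g n)))) g = Some (the (\<Gamma> g))"
      using Phi[OF g] g by auto
    then show "computes g (learner e (pre g (LEAST n. W (fst_code z) (pre g n)))) (snd_code z)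
        (the (\<Gamma> g) (snd_code z))"
      by (rule Phi_eq_SomeD)
  qed (intro effective_intros)
  from parameter_theorem[OF this] obtain d where d: "computable d"
    "\<forall>i g x. ?C g (prod_encode (i, x)) \<longrightarrow> computes g (d i) x (the (\<Gamma> g) (snd_code (prod_encode (i, x))))"
    by blast
  have "\<Gamma> g = Phi (d i) g" if "g \<in> dom \<Gamma>" "L g = i" for g i
  proof -
    have "Phi (d i) g = Some (the (\<Gamma> g))" using d(2)[rule_format, of g i] that by (intro Phi_eq_SomeI) simp
    then show ?thesis using \<open>g \<in> dom \<Gamma>\<close> by auto
  qed
  then show ?thesis unfolding piecewise_def using d(1) by blast
qed

subsection \<open>From learners to decompositions\<close>

definition mind_changes :: "nat \<Rightarrow> nat list \<Rightarrow> nat" where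
  "mind_changes e \<sigma> = (\<Sum>n<length \<sigma>. of_bool (learner e (take (Suc n) \<sigma>) \<noteq> learner e (take n \<sigma>)))"

lemma effective_on_mind_changes [effective_intros]:
  assumes "effective_on C (\<lambda>g x. list_encode (L g x))"
  shows "effective_on C (\<lambda>g x. mind_changes e (L g x))"
proof (rule effective_on_list_comp[OF _ assms])
  show "effective (\<lambda>g x. mind_changes e (list_decode x))"
    unfolding mind_changes_def by (intro effective_intros)
qed

lemma mind_changes_pre: "mind_changes e (pre g n) = card (mcl (learner e) g \<inter> {..<n})"
proof -
  have "mind_changes e (pre g n) = (\<Sum>m<n. of_bool (m \<in> mcl (learner e) g))"
    unfolding mind_changes_def length_pre by (intro sum.cong) (auto simp: mcl_def)
  also have "\<dots> = card (mcl (learner e) g \<inter> {..<n})"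
    by (simp add: sum_of_bool_eq Int_commute)
  finally show ?thesis .
qed

text \<open>"At most \<open>i\<close> mind changes" is refuted by a finite prefix and hence is
  Pi-0-1; "exactly \<open>i\<close>" is a difference of two such conditions, which is the form of a
  layer.\<close>

lemma CT_subset_layers_Pi01: "CT 1 X \<infinity> \<subseteq> dec Layer X Pi01"
proof
  fix \<Gamma> assume "\<Gamma> \<in> CT 1 X \<infinity>"
  then obtain e where e: "\<forall>g \<in> dom \<Gamma>. learns (learner e) X \<infinity> \<Gamma> g" unfolding CT_1_iff by blast
  let ?M = "\<lambda>g. mcl (learner e) g"
  let ?L = "\<lambda>g. card (?M g)"
  let ?T = "\<lambda>i. {f. \<forall>n. mind_changes e (pre f n) \<le> i}"
  have conv: "\<exists>p. (\<lambda>n. learner e (pre g n)) \<longlonglongrightarrow> p \<and> Phi p g = \<Gamma> g" if "g \<in> dom \<Gamma>" for g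
    using e that by (auto simp: learns_def)
  have fin: "finite (?M g)" if "g \<in> dom \<Gamma>" for g
    using conv[OF that] mcl_finite by blast
  have all: "\<exists>n. ?M g \<subseteq> {..<n}" if "g \<in> dom \<Gamma>" for g
    using fin[OF that] by (simp add: finite_nat_iff_bounded)
  have L: "?L g \<in> segment X" if "g \<in> dom \<Gamma>" for g
  proof -
    have "ecard (?M g) < X" using e that by (simp add: learns_def)
    then show ?thesis using fin[OF that] by (simp add: ecard_def segment_def)
  qed
  have T: "g \<in> ?T i \<longleftrightarrow> ?L g \<le> i" if g: "g \<in> dom \<Gamma>" for g i
  proof
    obtain n where n: "?M g \<subseteq> {..<n}" using all[OF g] by blast
    assume "g \<in> ?T i"
    then have "mind_changes e (pre g n) \<le> i" by blast
    then show "?L g \<le> i" using n by (simp add: mind_changes_pre Int_absorb2)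
  next
    assume "?L g \<le> i"
    moreover have "mind_changes e (pre g n) \<le> ?L g" for n
      unfolding mind_changes_pre using fin[OF g] by (intro card_mono) auto
    ultimately show "g \<in> ?T i" using le_trans by blast
  qed
  have mono: "?T i \<subseteq> ?T (Suc i)" for i by (auto intro: le_SucI)
  have dec: "decidable (\<lambda>i \<sigma>. mind_changes e \<sigma> \<le> i)" by (intro decidableI effective_intros)
  have "uniform_layer Pi01 (segment X) (dom \<Gamma>) (\<lambda>i. {g \<in> dom \<Gamma>. ?L g = i})"
    unfolding uniform_layer_def
  proof (intro exI[of _ ?T] conjI ballI)
    show "uniformly Pi01 (segment X) ?T" using dec by (rule uniformly_Pi01I)
    show "\<forall>i. Suc i \<in> segment X \<longrightarrow> ?T i \<subseteq> ?T (Suc i)" using mono by (intro allI impI)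
    show "dom \<Gamma> \<subseteq> (\<Union>i\<in>segment X. ?T i)"
    proof
      fix g assume g: "g \<in> dom \<Gamma>"
      have "g \<in> ?T (?L g)" using T[OF g, of "?L g"] by blast
      then show "g \<in> (\<Union>i\<in>segment X. ?T i)" using L[OF g] by (intro UN_I)
    qed
    show "{g \<in> dom \<Gamma>. ?L g = i} = dom \<Gamma> \<inter> (?T i - (case i of 0 \<Rightarrow> {} | Suc j \<Rightarrow> ?T j))" for i
    proof (intro set_eqI)
      fix g
      show "g \<in> {g \<in> dom \<Gamma>. ?L g = i} \<longleftrightarrow> g \<in> dom \<Gamma> \<inter> (?T i - (case i of 0 \<Rightarrow> {} | Suc j \<Rightarrow> ?T j))"
      proof (cases "g \<in> dom \<Gamma>")
        case True
        show ?thesis by (cases i) (use True T[OF True] in \<open>simp_all only: nat.case Diff_iff Int_iff mem_Collect_eq empty_iff\<close>, auto)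
      qed blast
    qed
  qed
  moreover have "piecewise (segment X) (\<lambda>i. {g \<in> dom \<Gamma>. ?L g = i}) \<Gamma>"
  proof (rule piecewise_searchI[where W = "\<lambda>i \<sigma>. mind_changes e \<sigma> = i" and e = e])
    show "decidable (\<lambda>i \<sigma>. mind_changes e \<sigma> = i)" by (intro decidableI effective_intros)
    show "\<exists>n. mind_changes e (pre g n) = ?L g" if "g \<in> dom \<Gamma>" for g
      using all[OF that] unfolding mind_changes_pre by (metis Int_absorb2)
    fix g n assume g: "g \<in> dom \<Gamma>" and "mind_changes e (pre g n) = ?L g"
    \<comment> \<open>The changes before \<open>n\<close> already number as many as there are in
      all, so none is left and the hypothesis at \<open>n\<close> is final.\<close>
    then have "?M g \<inter> {..<n} = ?M g"
      using fin[OF g] by (intro card_subset_eq) (auto simp: mind_changes_pre)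
    then have M: "?M g \<subseteq> {..<n}" by blast
    have const: "learner e (pre g m) = learner e (pre g n)" if "m \<ge> n" for m
      using that
    proof (induction m rule: dec_induct)
      case (step m)
      then have "m \<notin> ?M g" using M by auto
      then show ?case using step by (simp add: mcl_def)
    qed simp
    then have "(\<lambda>m. learner e (pre g m)) \<longlonglongrightarrow> learner e (pre g n)"
      by (intro tendsto_eventually eventually_sequentiallyI[of n])
    then show "Phi (learner e (pre g n)) g = \<Gamma> g" using conv[OF g] LIMSEQ_unique by blast
  qed
  ultimately show "\<Gamma> \<in> dec Layer X Pi01"
    unfolding dec_def mem_Collect_eq decomposition.simps by (intro exI conjI)
qed

section \<open>The stage of the last mind change\<close>

definition settle :: "(nat \<Rightarrow> nat) \<Rightarrow> nat" where
  "settle a = (LEAST N. \<forall>n\<ge>N. a n = a N)"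

lemma settle_limit:
  assumes "\<forall>n\<ge>N. a n = p" and "n \<ge> settle a"
  shows "a n = p"
proof -
  have "\<forall>n\<ge>N. a n = a N" using assms(1) by simp
  then have "\<forall>n\<ge>settle a. a n = a (settle a)" unfolding settle_def by (rule LeastI)
  from this[rule_format] have "a n = a (settle a)" "a (max N (settle a)) = a (settle a)"
    using assms(2) by (blast, metis max.cobounded2)
  moreover have "a (max N (settle a)) = p" using assms(1) by simp
  ultimately show ?thesis by simp
qed

lemma settle_le_iff:
  assumes "\<forall>n\<ge>N. a n = p"
  shows "(\<forall>n\<ge>i. a n = a i) \<longleftrightarrow> settle a \<le> i"
proof
  assume "settle a \<le> i"
  then have "a n = p" if "n \<ge> i" for n using settle_limit[OF assms, of n] that by simp
  then show "\<forall>n\<ge>i. a n = a i" by simp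
qed (unfold settle_def, rule Least_le)

text \<open>Constancy from \<open>i\<close> on bounds the settling stage by \<open>i\<close>; a
  change immediately before \<open>i\<close> shows that it is not earlier. At 0 there is no previous
  value to compare.\<close>

lemma settle_eq_iff:
  assumes "\<forall>n\<ge>N. a n = p"
  shows "(\<forall>n\<ge>i. a n = a i) \<and> (i \<noteq> 0 \<longrightarrow> a (i - 1) \<noteq> a i) \<longleftrightarrow> settle a = i"
proof
  assume i: "(\<forall>n\<ge>i. a n = a i) \<and> (i \<noteq> 0 \<longrightarrow> a (i - 1) \<noteq> a i)"
  then have le: "settle a \<le> i" using settle_le_iff[OF assms] by blast
  show "settle a = i"
  proof (rule ccontr)
    assume "settle a \<noteq> i"
    then have "settle a \<le> i - 1" "i \<noteq> 0" using le by auto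
    then have "a (i - 1) = p" "a i = p" using settle_limit[OF assms] le by blast+
    then show False using conjunct2[OF i] \<open>i \<noteq> 0\<close> by simp
  qed
next
  assume i: "settle a = i"
  have "a (i - 1) \<noteq> a i" if "i \<noteq> 0"
  proof
    assume eq: "a (i - 1) = a i"
    have "a n = p" if "n \<ge> i" for n using settle_limit[OF assms] that i by simp
    moreover have "n = i - 1 \<or> n \<ge> i" if "n \<ge> i - 1" for n using that by linarith
    ultimately have "\<forall>n\<ge>i - 1. a n = a (i - 1)" using eq by (metis order_refl)
    then have "settle a \<le> i - 1" using settle_le_iff[OF assms] by blast
    then show False using i \<open>i \<noteq> 0\<close> by simp
  qed
  then show "(\<forall>n\<ge>i. a n = a i) \<and> (i \<noteq> 0 \<longrightarrow> a (i - 1) \<noteq> a i)"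
    using settle_le_iff[OF assms, of i] i by blast
qed

lemma CT_subset_dec_Pi01: "CT 1 \<infinity> \<infinity> \<subseteq> dec x \<infinity> Pi01"
proof
  fix \<Gamma> assume "\<Gamma> \<in> CT 1 \<infinity> \<infinity>"
  then obtain e where e: "\<forall>g \<in> dom \<Gamma>. learns (learner e) \<infinity> \<infinity> \<Gamma> g" unfolding CT_1_iff by blast
  define L where "L g = settle (\<lambda>n. learner e (pre g n))" for g
  define P where "P i \<sigma> \<longleftrightarrow> (i \<le> length \<sigma> \<longrightarrow> learner e \<sigma> = learner e (take i \<sigma>))" for i \<sigma>
  \<comment> \<open>The additional conjunct is decided by the prefix of length \<open>i\<close>, so
    fixing the settling stage exactly remains a Pi-0-1 condition. This is why partitions are
    possible here.\<close>
  define P' where "P' i \<sigma> \<longleftrightarrow> P i \<sigma> \<and> (i \<le> length \<sigma> \<longrightarrow> i \<noteq> 0 \<longrightarrow>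
    learner e (take (i - 1) \<sigma>) \<noteq> learner e (take i \<sigma>))" for i \<sigma>
  have conv: "\<exists>N p. (\<forall>n\<ge>N. learner e (pre g n) = p) \<and> Phi p g = \<Gamma> g" if "g \<in> dom \<Gamma>" for g
    using e that unfolding learns_def tendsto_discrete eventually_sequentially by blast
  have P: "(\<forall>n. P i (pre g n)) \<longleftrightarrow> (\<forall>n\<ge>i. learner e (pre g n) = learner e (pre g i))" for g i
    unfolding P_def length_pre by auto
  have P': "(\<forall>n. P' i (pre g n)) \<longleftrightarrow> (\<forall>n\<ge>i. learner e (pre g n) = learner e (pre g i)) \<and>
      (i \<noteq> 0 \<longrightarrow> learner e (pre g (i - 1)) \<noteq> learner e (pre g i))" for g i
  proof -
    have "(\<forall>n. i \<le> n \<longrightarrow> i \<noteq> 0 \<longrightarrow>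
        learner e (take (i - 1) (pre g n)) \<noteq> learner e (take i (pre g n))) \<longleftrightarrow>
      (i \<noteq> 0 \<longrightarrow> learner e (pre g (i - 1)) \<noteq> learner e (pre g i))" by auto
    then show ?thesis unfolding P'_def all_conj_distrib P length_pre by (simp only:)
  qed
  have dec: "decidable P" "decidable P'"
    unfolding P'_def P_def by (intro decidableI effective_intros)+
  have "decomposition x Pi01 (segment \<infinity>) (dom \<Gamma>) (\<lambda>i. {g \<in> dom \<Gamma>. L g = i})"
  proof (rule decomposition_rankI)
    show "uniformly Pi01 (segment \<infinity>) (\<lambda>i. {f. \<forall>n. P' i (pre f n)})"
      "uniformly Pi01 (segment \<infinity>) (\<lambda>i. {f. \<forall>n. P i (pre f n)})"
      by (rule uniformly_Pi01I[OF dec(2)], rule uniformly_Pi01I[OF dec(1)])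
    show "g \<in> {f. \<forall>n. P' i (pre f n)} \<longleftrightarrow> L g = i" if g: "g \<in> dom \<Gamma>" for g i
    proof -
      obtain N p where "\<forall>n\<ge>N. learner e (pre g n) = p" using conv[OF g] by blast
      from settle_eq_iff[OF this] show ?thesis unfolding mem_Collect_eq P' L_def .
    qed
    show "g \<in> {f. \<forall>n. P i (pre f n)} \<longleftrightarrow> L g \<le> i" if g: "g \<in> dom \<Gamma>" for g i
    proof -
      obtain N p where "\<forall>n\<ge>N. learner e (pre g n) = p" using conv[OF g] by blast
      from settle_le_iff[OF this] show ?thesis unfolding mem_Collect_eq P L_def .
    qed
    show "{f. \<forall>n. P i (pre f n)} \<subseteq> {f. \<forall>n. P (Suc i) (pre f n)}" for i
    proof
      fix g assume "g \<in> {f. \<forall>n. P i (pre f n)}"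
      then have c: "\<forall>n\<ge>i. learner e (pre g n) = learner e (pre g i)" unfolding mem_Collect_eq P .
      have "learner e (pre g n) = learner e (pre g (Suc i))" if "n \<ge> Suc i" for n
        using c[rule_format, of n] c[rule_format, of "Suc i"] that by simp
      then show "g \<in> {f. \<forall>n. P (Suc i) (pre f n)}" unfolding mem_Collect_eq P by blast
    qed
  qed simp
  moreover have "piecewise (segment \<infinity>) (\<lambda>i. {g \<in> dom \<Gamma>. L g = i}) \<Gamma>"
  \<comment> \<open>The piece number is itself the stage at which the final hypothesis
    stands.\<close>
  proof (rule piecewise_searchI[where W = "\<lambda>i \<sigma>. length \<sigma> = i" and e = e])
    show "decidable (\<lambda>i \<sigma>. length \<sigma> = i)" by (intro decidableI effective_intros)
    fix g n assume g: "g \<in> dom \<Gamma>" and "length (pre g n) = L g"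
    then have n: "settle (\<lambda>n. learner e (pre g n)) \<le> n" by (simp add: L_def)
    obtain N p where p: "\<forall>n\<ge>N. learner e (pre g n) = p" "Phi p g = \<Gamma> g" using conv[OF g] by blast
    then show "Phi (learner e (pre g n)) g = \<Gamma> g" using settle_limit[OF p(1) n] by simp
  qed simp
  ultimately show "\<Gamma> \<in> dec x \<infinity> Pi01"
    unfolding dec_def mem_Collect_eq by (intro exI conjI)
qed


section \<open>Hypotheses in the order of their first appearance\<close>

definition first_seen :: "(nat \<Rightarrow> nat) \<Rightarrow> nat \<Rightarrow> nat" where
  "first_seen a n = (LEAST m. a m = a n)"

text \<open>The number of values of \<open>a\<close> that appear before the value \<open>a n\<close> first does.\<close>

definition rank :: "(nat \<Rightarrow> nat) \<Rightarrow> nat \<Rightarrow> nat" where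
  "rank a n = card {m. m < first_seen a n \<and> first_seen a m = m}"

lemma first_seen_eq: "a (first_seen a n) = a n"
  unfolding first_seen_def by (rule LeastI) (rule refl)

lemma first_seen_le: "first_seen a n \<le> n"
  unfolding first_seen_def by (rule Least_le) (rule refl)

lemma first_seen_cong: "a m = a n \<Longrightarrow> first_seen a m = first_seen a n"
  unfolding first_seen_def by simp

lemma rank_cong: "a m = a n \<Longrightarrow> rank a m = rank a n"
  unfolding rank_def using first_seen_cong[of a m n] by simp

lemma rank_less:
  assumes "first_seen a m < first_seen a n"
  shows "rank a m < rank a n"
proof -
  let ?A = "\<lambda>n. {m. m < first_seen a n \<and> first_seen a m = m}"
  have "?A m \<subseteq> ?A n" using assms by auto
  \<comment> \<open>The first occurrence of the earlier value is counted for \<open>n\<close> but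
    not for \<open>m\<close>, which makes the inclusion strict.\<close>
  moreover have "first_seen a m \<in> ?A n" "first_seen a m \<notin> ?A m"
    using assms first_seen_cong[of a "first_seen a m" m, OF first_seen_eq] by simp_all
  ultimately have "?A m \<subset> ?A n" by blast
  then show ?thesis unfolding rank_def by (intro psubset_card_mono) simp_all
qed

lemma rank_eqD:
  assumes "rank a m = rank a n"
  shows "a m = a n"
proof -
  have "first_seen a m = first_seen a n"
    using rank_less[of a m n] rank_less[of a n m] assms by (metis less_irrefl linorder_neqE_nat)
  then show ?thesis using first_seen_eq by metis
qed

text \<open>The values counted are distinct from each other and from \<open>a n\<close> itself; this
  missing value gives the strict inequality, so that at most \<open>k\<close> values yield ranks
  below \<open>k\<close>.\<close>

lemma rank_less_card:
  assumes "finite (range a)"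
  shows "rank a n < card (range a)"
proof -
  let ?A = "{m. m < first_seen a n \<and> first_seen a m = m}"
  have "inj_on a ?A"
  proof (rule inj_onI)
    fix x y assume "x \<in> ?A" "y \<in> ?A" "a x = a y"
    then show "x = y" using first_seen_cong[of a x y] by simp
  qed
  moreover have "a ` ?A \<subseteq> range a - {a n}"
  proof
    fix v assume "v \<in> a ` ?A"
    then obtain m where "m < first_seen a n" "v = a m" by blast
    then show "v \<in> range a - {a n}"
      using not_less_Least[of m "\<lambda>m. a m = a n"] unfolding first_seen_def by simp
  qed
  ultimately have "card ?A \<le> card (range a - {a n})" using assms by (intro card_inj_on_le) simp_all
  also have "\<dots> < card (range a)" using assms by (intro card_Diff1_less) simp_all
  finally show ?thesis unfolding rank_def .
qed

text \<open>With \<open>appearance\<close>, the counterparts of \<open>first_seen\<close> and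
  \<open>rank\<close> that read only a finite string and are therefore computable.\<close>

definition first_occurrence :: "nat \<Rightarrow> nat list \<Rightarrow> nat" where
  "first_occurrence e \<sigma> = (LEAST m. learner e (take m \<sigma>) = learner e \<sigma>)"

definition appearance :: "nat \<Rightarrow> nat list \<Rightarrow> nat" where
  "appearance e \<sigma> = (\<Sum>m<first_occurrence e \<sigma>. of_bool (first_occurrence e (take m \<sigma>) = m))"

lemma effective_on_first_occurrence [effective_intros]:
  assumes "effective_on C (\<lambda>g x. list_encode (L g x))"
  shows "effective_on C (\<lambda>g x. first_occurrence e (L g x))"
proof (rule effective_on_list_comp[OF _ assms])
  have "\<exists>m. learner e (take m \<sigma>) = learner e \<sigma>" for \<sigma> by (rule exI[of _ "length \<sigma>"]) simp
  then show "effective (\<lambda>g x. first_occurrence e (list_decode x))"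
    unfolding first_occurrence_def by (intro effective_on_Least effective_intros)
qed

lemma computable_appearance: "computable (\<lambda>u. appearance e (list_decode u))"
  unfolding appearance_def by (intro effective_computable effective_intros)

lemma first_occurrence_pre: "first_occurrence e (pre g n) = first_seen (\<lambda>n. learner e (pre g n)) n"
proof -
  let ?a = "\<lambda>n. learner e (pre g n)"
  show ?thesis unfolding first_occurrence_def
  proof (rule Least_equality)
    show "learner e (take (first_seen ?a n) (pre g n)) = learner e (pre g n)"
      using first_seen_eq[of ?a n] first_seen_le[of ?a n] by simp
    fix m assume m: "learner e (take m (pre g n)) = learner e (pre g n)"
    show "first_seen ?a n \<le> m"
    proof (cases "m \<le> n")
      case True
      then show ?thesis using m unfolding first_seen_def by (intro Least_le) simp
    next
      case False
      then show ?thesis using first_seen_le[of ?a n] by simp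
    qed
  qed
qed

lemma appearance_pre: "appearance e (pre g n) = rank (\<lambda>n. learner e (pre g n)) n"
proof -
  let ?a = "\<lambda>n. learner e (pre g n)"
  have "appearance e (pre g n) = (\<Sum>m<first_seen ?a n. of_bool (first_seen ?a m = m))"
    unfolding appearance_def first_occurrence_pre
  proof (intro sum.cong refl)
    fix m assume "m \<in> {..<first_seen ?a n}"
    then have "m \<le> n" using first_seen_le[of ?a n] by simp
    then show "of_bool (first_occurrence e (take m (pre g n)) = m) = (of_bool (first_seen ?a m = m) :: nat)"
      by (simp only: take_pre first_occurrence_pre)
  qed
  also have "\<dots> = card ({..<first_seen ?a n} \<inter> {m. first_seen ?a m = m})"
    by (simp add: sum_of_bool_eq)
  also have "{..<first_seen ?a n} \<inter> {m. first_seen ?a m = m} = {m. m < first_seen ?a n \<and> first_seen ?a m = m}"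
    by blast
  finally show ?thesis unfolding rank_def .
qed

text \<open>If \<open>r\<close> converges to \<open>L g\<close>, then a condition on
  \<open>L g\<close> holds exactly if it holds of \<open>r\<close> eventually, and exactly if it
  holds infinitely often. The first form is Sigma-0-2, the second Pi-0-2; convergence is known only
  on \<open>Q\<close>.\<close>

lemma limit_decomposition:
  assumes comp: "computable (\<lambda>u. r (list_decode u))"
    and seg: "\<And>g. g \<in> Q \<Longrightarrow> L g \<in> segment X"
    and lim: "\<And>g. g \<in> Q \<Longrightarrow> \<exists>N. \<forall>n\<ge>N. r (pre g n) = L g"
  shows "decomposition x Sigma02 (segment X) Q (\<lambda>i. {g \<in> Q. L g = i})"
    and "decomposition x Pi02 (segment X) Q (\<lambda>i. {g \<in> Q. L g = i})"
proof -
  note [effective_intros] = effective_on_computable_list[OF comp]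
  \<comment> \<open>The double negation in the second claim is the normal form of a Pi-0-2 family in
    \<open>uniformly_Pi02I\<close>.\<close>
  have ev: "g \<in> {f. \<exists>m. \<forall>n. m \<le> length (pre f n) \<longrightarrow> B (r (pre f n))} \<longleftrightarrow> B (L g)"
    and inf: "g \<in> {f. \<forall>m. \<exists>n. \<not> (m \<le> length (pre f n) \<longrightarrow> \<not> B (r (pre f n)))} \<longleftrightarrow> B (L g)"
    if "g \<in> Q" for g B
  proof -
    obtain N where N: "\<And>n. n \<ge> N \<Longrightarrow> r (pre g n) = L g" using lim[OF \<open>g \<in> Q\<close>] by blast
    have "(\<exists>m. \<forall>n. m \<le> n \<longrightarrow> B (r (pre g n))) \<longleftrightarrow> B (L g)" (is "?l \<longleftrightarrow> _")
    proof
      assume ?l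
      then obtain m where "\<forall>n. m \<le> n \<longrightarrow> B (r (pre g n))" by blast
      then have "B (r (pre g (max m N)))" by simp
      then show "B (L g)" using N[of "max m N"] by simp
    next
      assume "B (L g)"
      then have "\<forall>n. N \<le> n \<longrightarrow> B (r (pre g n))" using N by simp
      then show ?l by blast
    qed
    then show "g \<in> {f. \<exists>m. \<forall>n. m \<le> length (pre f n) \<longrightarrow> B (r (pre f n))} \<longleftrightarrow> B (L g)" by simp
    have "(\<forall>m. \<exists>n. m \<le> n \<and> B (r (pre g n))) \<longleftrightarrow> B (L g)" (is "?l \<longleftrightarrow> _")
    proof
      assume ?l
      then obtain n where "N \<le> n" "B (r (pre g n))" by blast
      then show "B (L g)" using N[of n] by simp
    next
      assume "B (L g)"
      then have "m \<le> max m N \<and> B (r (pre g (max m N)))" for m using N[of "max m N"] by simp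
      then show ?l by blast
    qed
    then show "g \<in> {f. \<forall>m. \<exists>n. \<not> (m \<le> length (pre f n) \<longrightarrow> \<not> B (r (pre f n)))} \<longleftrightarrow> B (L g)" by simp
  qed
  show "decomposition x Sigma02 (segment X) Q (\<lambda>i. {g \<in> Q. L g = i})"
  proof (rule decomposition_rankI[OF seg])
    show "uniformly Sigma02 (segment X) (\<lambda>i. {f. \<exists>m. \<forall>n. m \<le> length (pre f n) \<longrightarrow> r (pre f n) = i})"
      by (rule uniformly_Sigma02I[of "\<lambda>m i \<sigma>. m \<le> length \<sigma> \<longrightarrow> r \<sigma> = i"])
        (intro decidable2I effective_intros)
    show "uniformly Sigma02 (segment X) (\<lambda>i. {f. \<exists>m. \<forall>n. m \<le> length (pre f n) \<longrightarrow> r (pre f n) \<le> i})"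
      by (rule uniformly_Sigma02I[of "\<lambda>m i \<sigma>. m \<le> length \<sigma> \<longrightarrow> r \<sigma> \<le> i"])
        (intro decidable2I effective_intros)
    show "g \<in> {f. \<exists>m. \<forall>n. m \<le> length (pre f n) \<longrightarrow> r (pre f n) = i} \<longleftrightarrow> L g = i" if "g \<in> Q" for g i
      using that by (rule ev)
    show "g \<in> {f. \<exists>m. \<forall>n. m \<le> length (pre f n) \<longrightarrow> r (pre f n) \<le> i} \<longleftrightarrow> L g \<le> i" if "g \<in> Q" for g i
      using that by (rule ev)
    show "{f. \<exists>m. \<forall>n. m \<le> length (pre f n) \<longrightarrow> r (pre f n) \<le> i} \<subseteq>
      {f. \<exists>m. \<forall>n. m \<le> length (pre f n) \<longrightarrow> r (pre f n) \<le> Suc i}" for i by (intro Collect_mono) (metis le_SucI)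
  qed
  show "decomposition x Pi02 (segment X) Q (\<lambda>i. {g \<in> Q. L g = i})"
  proof (rule decomposition_rankI[OF seg])
    show "uniformly Pi02 (segment X)
        (\<lambda>i. {f. \<forall>m. \<exists>n. \<not> (m \<le> length (pre f n) \<longrightarrow> \<not> r (pre f n) = i)})"
      by (rule uniformly_Pi02I[of "\<lambda>m i \<sigma>. m \<le> length \<sigma> \<longrightarrow> \<not> r \<sigma> = i"])
        (intro decidable2I effective_intros)
    show "uniformly Pi02 (segment X)
        (\<lambda>i. {f. \<forall>m. \<exists>n. \<not> (m \<le> length (pre f n) \<longrightarrow> \<not> r (pre f n) \<le> i)})"
      by (rule uniformly_Pi02I[of "\<lambda>m i \<sigma>. m \<le> length \<sigma> \<longrightarrow> \<not> r \<sigma> \<le> i"])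
        (intro decidable2I effective_intros)
    show "g \<in> {f. \<forall>m. \<exists>n. \<not> (m \<le> length (pre f n) \<longrightarrow> \<not> r (pre f n) = i)} \<longleftrightarrow> L g = i" if "g \<in> Q" for g i
      using that by (rule inf)
    show "g \<in> {f. \<forall>m. \<exists>n. \<not> (m \<le> length (pre f n) \<longrightarrow> \<not> r (pre f n) \<le> i)} \<longleftrightarrow> L g \<le> i" if "g \<in> Q" for g i
      using that by (rule inf)
    show "{f. \<forall>m. \<exists>n. \<not> (m \<le> length (pre f n) \<longrightarrow> \<not> r (pre f n) \<le> i)} \<subseteq>
      {f. \<forall>m. \<exists>n. \<not> (m \<le> length (pre f n) \<longrightarrow> \<not> r (pre f n) \<le> Suc i)}" for i
      by (intro Collect_mono) (metis le_SucI)
  qed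
qed

lemma CT_subset_dec_relDelta02: "CT 1 \<infinity> X \<subseteq> dec_relDelta02 x X"
proof
  fix \<Gamma> assume "\<Gamma> \<in> CT 1 \<infinity> X"
  then obtain e where e: "\<forall>g \<in> dom \<Gamma>. learns (learner e) \<infinity> X \<Gamma> g" unfolding CT_1_iff by blast
  define a where "a g n = learner e (pre g n)" for g n
  have conv: "\<exists>N p. (\<forall>n\<ge>N. a g n = p) \<and> Phi p g = \<Gamma> g" if "g \<in> dom \<Gamma>" for g
    using e that unfolding learns_def tendsto_discrete eventually_sequentially a_def by blast
  define L where "L g = rank (a g) (settle (a g))" for g
  have app: "appearance e (pre g n) = rank (a g) n" for g n
    unfolding appearance_pre a_def ..
  have lim: "\<exists>N. \<forall>n\<ge>N. appearance e (pre g n) = L g" if g: "g \<in> dom \<Gamma>" for g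
  proof -
    obtain N p where p: "\<forall>n\<ge>N. a g n = p" using conv[OF g] by blast
    have "appearance e (pre g n) = L g" if "n \<ge> settle (a g)" for n
      unfolding app L_def using settle_limit[OF p that] settle_limit[OF p order_refl]
      by (intro rank_cong) simp
    then show ?thesis by blast
  qed
  have seg: "L g \<in> segment X" if g: "g \<in> dom \<Gamma>" for g
  proof (cases X)
    case (enat k)
    have "indx (learner e) g = range (a g)" by (auto simp: indx_def a_def)
    moreover have "ecard (indx (learner e) g) \<le> enat k" using e g enat by (simp add: learns_def)
    ultimately have fin: "finite (range (a g))" "card (range (a g)) \<le> k"
      by (auto simp: ecard_def split: if_splits)
    have "L g < card (range (a g))" unfolding L_def using fin(1) by (rule rank_less_card)
    then show ?thesis using fin(2) enat by simp
  qed simp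
  have "piecewise (segment X) (\<lambda>i. {g \<in> dom \<Gamma>. L g = i}) \<Gamma>"
  proof (rule piecewise_searchI[where W = "\<lambda>i \<sigma>. appearance e \<sigma> = i" and e = e])
    show "decidable (\<lambda>i \<sigma>. appearance e \<sigma> = i)"
      by (intro decidableI effective_intros effective_on_computable_list[OF computable_appearance])
    show "\<exists>n. appearance e (pre g n) = L g" if "g \<in> dom \<Gamma>" for g using lim[OF that] by blast
    fix g n assume g: "g \<in> dom \<Gamma>" and n: "appearance e (pre g n) = L g"
    obtain N p where p: "\<forall>n\<ge>N. a g n = p" "Phi p g = \<Gamma> g" using conv[OF g] by blast
    \<comment> \<open>The learner need not have settled at \<open>n\<close> and may still leave this
      hypothesis; equal rank alone makes it the final one.\<close>
    have "rank (a g) n = rank (a g) (settle (a g))" using n by (simp only: app L_def)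
    from rank_eqD[OF this] have "a g n = p" by (simp only: settle_limit[OF p(1) order_refl])
    then show "Phi (learner e (pre g n)) g = \<Gamma> g" using p(2) by (simp only: a_def[symmetric])
  qed
  then show "\<Gamma> \<in> dec_relDelta02 x X"
    unfolding dec_relDelta02_def mem_Collect_eq
    using limit_decomposition[OF computable_appearance seg lim] by (intro exI conjI)
qed

subsection \<open>From decompositions to learners\<close>

lemma ecard_image_segment: "ecard (f ` segment X) \<le> X"
proof (cases X)
  case (enat k)
  then show ?thesis using card_image_le[of "{..<k}" f] by (simp add: ecard_def)
qed simp

text \<open>Only finitely many candidates lie below \<open>i\<close>, so their eventual refutations
  have a common stage.\<close>

lemma eventually_Least_eq:
  fixes P :: "nat \<Rightarrow> nat \<Rightarrow> bool"
  assumes "eventually (\<lambda>n. P n i) sequentially"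
    and "\<And>j. j < i \<Longrightarrow> eventually (\<lambda>n. \<not> P n j) sequentially"
  shows "eventually (\<lambda>n. (LEAST j. P n j) = i) sequentially"
proof -
  have "eventually (\<lambda>n. \<forall>j\<in>{..<i}. \<not> P n j) sequentially"
    using assms(2) by (intro eventually_ball_finite) auto
  with assms(1) show ?thesis
  proof eventually_elim
    case (elim n)
    then show ?case by (intro Least_equality) (auto simp: not_less[symmetric])
  qed
qed

lemma eventually_violated:
  assumes "\<not> P (pre g m)"
  shows "eventually (\<lambda>n. \<not> (\<forall>l\<le>length (pre g n). P (take l (pre g n)))) sequentially"
proof (rule eventually_sequentiallyI[of m])
  fix n assume "m \<le> n"
  then show "\<not> (\<forall>l\<le>length (pre g n). P (take l (pre g n)))"
    using assms by (intro notI) (auto dest: spec[of _ m])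
qed

lemma covers_Sigma02_subset_CT: "dec Cover X Sigma02 \<subseteq> CT 1 \<infinity> X"
proof
  fix \<Gamma> assume "\<Gamma> \<in> dec Cover X Sigma02"
  then obtain R e S where e: "computable e" "\<forall>i \<in> segment X. \<forall>g \<in> R i. \<Gamma> g = Phi (e i) g"
    and S: "uniformly Sigma02 (segment X) S" "\<forall>i \<in> segment X. R i = dom \<Gamma> \<inter> S i"
    and cover: "(\<Union>i \<in> segment X. R i) = dom \<Gamma>"
    unfolding dec_def mem_Collect_eq decomposition.simps uniform_cover_def piecewise_def by blast
  obtain P where P: "decidable2 P" "\<forall>i\<in>segment X. S i = {f. \<exists>m. \<forall>n. P m i (pre f n)}"
    using uniformly_Sigma02D[OF S(1)] by blast
  define good where "good q \<sigma> \<longleftrightarrow> fst_code q \<in> segment X \<and>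
    (\<forall>n\<le>length \<sigma>. P (snd_code q) (fst_code q) (take n \<sigma>))" for q \<sigma>
  \<comment> \<open>The bound by the length makes the search, and hence the learner, total. It has
    no effect in the limit, where the length exceeds every fixed candidate.\<close>
  define guess where "guess \<sigma> = (LEAST q. length \<sigma> \<le> q \<or> good q \<sigma>)" for \<sigma>
  \<comment> \<open>A guess that is only due to the length bound may name a piece outside the
    segment. Falling back to piece 0 keeps all hypotheses among the indices of actual pieces, which
    gives the bound \<open>X\<close> on their number.\<close>
  define \<Psi> where "\<Psi> \<sigma> = e (if fst_code (guess \<sigma>) \<in> segment X then fst_code (guess \<sigma>) else 0)" for \<sigma>
  have ex: "\<exists>q. length \<sigma> \<le> q \<or> good q \<sigma>" for \<sigma> by blast
  have "effective (\<lambda>g u. guess (list_decode u))"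
    unfolding guess_def using ex
    by (intro effective_on_Least) (unfold good_def, intro effective_intros effective_on_decidable2[OF P(1)], blast)
  then have "computable (\<lambda>u. \<Psi> (list_decode u))" unfolding \<Psi>_def
    by (intro effective_computable effective_intros computable_effective_on[OF e(1)])
  then obtain d where d: "\<forall>\<beta> \<gamma> \<Gamma> g. learns \<Psi> \<beta> \<gamma> \<Gamma> g \<longrightarrow> learns (learner d) \<beta> \<gamma> \<Gamma> g"
    using total_learner_learns by blast
  have "learns \<Psi> \<infinity> X \<Gamma> g" if g: "g \<in> dom \<Gamma>" for g
  proof -
    define true where "true q \<longleftrightarrow> fst_code q \<in> segment X \<and> (\<forall>n. P (snd_code q) (fst_code q) (pre g n))" for q
    have "\<exists>i\<in>segment X. g \<in> R i" using g cover by blast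
    then obtain i where i: "i \<in> segment X" "g \<in> R i" by blast
    then have "g \<in> S i" using S(2) by blast
    then obtain m where "\<forall>n. P m i (pre g n)" using P(2) i(1) by blast
    then have "true (prod_encode (i, m))" unfolding true_def using i(1) by simp
    then have true: "true (LEAST q. true q)" by (rule LeastI)
    define q where "q = (LEAST q. true q)"
    have "true q" using true unfolding q_def .
    then have q: "fst_code q \<in> segment X" "\<forall>n. P (snd_code q) (fst_code q) (pre g n)"
      unfolding true_def by simp_all
    have "eventually (\<lambda>n. guess (pre g n) = q) sequentially"
      unfolding guess_def
    proof (rule eventually_Least_eq[where P = "\<lambda>n q. length (pre g n) \<le> q \<or> good q (pre g n)"])
      have "good q (pre g n)" for n using q unfolding good_def by simp
      then show "eventually (\<lambda>n. length (pre g n) \<le> q \<or> good q (pre g n)) sequentially" by simp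
      fix j assume "j < q"
      then have "\<not> true j" unfolding q_def by (rule not_less_Least)
      have "eventually (\<lambda>n. \<not> good j (pre g n)) sequentially"
      proof (cases "fst_code j \<in> segment X")
        case True
        then obtain m where "\<not> P (snd_code j) (fst_code j) (pre g m)"
          using \<open>\<not> true j\<close> unfolding true_def by blast
        from eventually_violated[of "P (snd_code j) (fst_code j)", OF this] show ?thesis
          unfolding good_def by (rule eventually_mono) blast
      qed (simp add: good_def)
      moreover have "eventually (\<lambda>n. j < n) sequentially" by (rule eventually_gt_at_top)
      ultimately show "eventually (\<lambda>n. \<not> (length (pre g n) \<le> j \<or> good j (pre g n))) sequentially"
        by eventually_elim simp
    qed
    then have "eventually (\<lambda>n. \<Psi> (pre g n) = e (fst_code q)) sequentially"
      by (rule eventually_mono) (simp add: \<Psi>_def q(1))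
    then have lim: "(\<lambda>n. \<Psi> (pre g n)) \<longlonglongrightarrow> e (fst_code q)" by (rule tendsto_eventually)
    have "g \<in> S (fst_code q)" using P(2) q by blast
    then have "g \<in> R (fst_code q)" using S(2) q(1) g by blast
    then have Phi: "Phi (e (fst_code q)) g = \<Gamma> g" using e(2) q(1) by simp
    \<comment> \<open>The fallback piece exists because \<open>g\<close> lies in some piece.\<close>
    have "0 \<in> segment X" using i(1) by (rule segment_downward) simp
    then have "indx \<Psi> g \<subseteq> e ` segment X" unfolding indx_def \<Psi>_def by auto
    then have "ecard (indx \<Psi> g) \<le> X" by (rule order_trans[OF ecard_mono ecard_image_segment])
    moreover have "ecard (mcl \<Psi> g) < \<infinity>" using mcl_finite[OF lim] by (simp add: ecard_def)
    ultimately show ?thesis unfolding learns_def using lim Phi by blast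
  qed
  then have "\<forall>g \<in> dom \<Gamma>. learns (learner d) \<infinity> X \<Gamma> g" using d by blast
  then show "\<Gamma> \<in> CT 1 \<infinity> X" unfolding CT_1_iff by (rule exI)
qed

text \<open>Each change is an increase, so the values reached by changes are distinct and lie in
  \<open>{1..K}\<close>.\<close>

lemma card_changes_mono_bounded:
  fixes h :: "nat \<Rightarrow> nat"
  assumes mono: "\<And>n. h n \<le> h (Suc n)" and bound: "\<And>n. h n \<le> K"
  shows "finite {n. h (Suc n) \<noteq> h n}" and "card {n. h (Suc n) \<noteq> h n} \<le> K"
proof -
  let ?M = "{n. h (Suc n) \<noteq> h n}"
  have le: "m \<le> n \<Longrightarrow> h m \<le> h n" for m n using mono by (rule lift_Suc_mono_le)
  have less: "h (Suc m) < h (Suc n)" if "n \<in> ?M" "m < n" for m n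
    using le[of "Suc m" n] mono[of n] that by simp
  have inj: "inj_on (\<lambda>n. h (Suc n)) ?M"
  proof (rule inj_onI)
    fix m n assume "m \<in> ?M" "n \<in> ?M" "h (Suc m) = h (Suc n)"
    then show "m = n" using less[of m n] less[of n m] by (metis less_irrefl linorder_neqE_nat)
  qed
  have sub: "(\<lambda>n. h (Suc n)) ` ?M \<subseteq> {1..K}"
  proof
    fix v assume "v \<in> (\<lambda>n. h (Suc n)) ` ?M"
    then obtain n where "h (Suc n) \<noteq> h n" "v = h (Suc n)" by blast
    then show "v \<in> {1..K}" using mono[of n] bound[of "Suc n"] by simp
  qed
  show "finite ?M" using inj_on_finite[OF inj sub] by simp
  show "card ?M \<le> K" using card_inj_on_le[OF inj sub] by simp
qed

lemma layers_Pi01_subset_CT: "dec Layer (enat k) Pi01 \<subseteq> CT 1 (enat k) \<infinity>"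
proof
  fix \<Gamma> assume "\<Gamma> \<in> dec Layer (enat k) Pi01"
  then obtain R e S where e: "computable e" "\<forall>i \<in> segment (enat k). \<forall>g \<in> R i. \<Gamma> g = Phi (e i) g"
    and S: "uniformly Pi01 (segment (enat k)) S" "dom \<Gamma> \<subseteq> (\<Union>i \<in> segment (enat k). S i)"
    and R: "\<forall>i \<in> segment (enat k). R i = dom \<Gamma> \<inter> (S i - (case i of 0 \<Rightarrow> {} | Suc j \<Rightarrow> S j))"
    unfolding dec_def mem_Collect_eq decomposition.simps uniform_layer_def piecewise_def by blast
  obtain P where P: "decidable P" "\<forall>i\<in>segment (enat k). S i = {f. \<forall>n. P i (pre f n)}"
    using uniformly_Pi01D[OF S(1)] by blast
  \<comment> \<open>The last layer \<open>k - 1\<close> is accepted untested. This makes the search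
    total and confines the guesses to \<open>k\<close> layers, hence to at most \<open>k - 1\<close>
    changes; it is the right answer once all earlier layers are refuted.\<close>
  define layer where "layer \<sigma> = (LEAST i. k \<le> Suc i \<or> (\<forall>n\<le>length \<sigma>. P i (take n \<sigma>)))" for \<sigma>
  have ex: "\<exists>i. k \<le> Suc i \<or> (\<forall>n\<le>length \<sigma>. P i (take n \<sigma>))" for \<sigma> by (rule exI[of _ k]) simp
  have "effective (\<lambda>g u. layer (list_decode u))"
    unfolding layer_def using ex by (intro effective_on_Least effective_intros effective_on_decidable[OF P(1)])
  then have "computable (\<lambda>u. e (layer (list_decode u)))"
    by (intro effective_computable computable_effective_on[OF e(1)])
  then obtain d where d: "\<forall>\<beta> \<gamma> \<Gamma> g. learns (\<lambda>\<sigma>. e (layer \<sigma>)) \<beta> \<gamma> \<Gamma> g \<longrightarrow> learns (learner d) \<beta> \<gamma> \<Gamma> g"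
    using total_learner_learns[of "\<lambda>\<sigma>. e (layer \<sigma>)"] by blast
  have "learns (\<lambda>\<sigma>. e (layer \<sigma>)) (enat k) \<infinity> \<Gamma> g" if g: "g \<in> dom \<Gamma>" for g
  proof -
    define i where "i = (LEAST i. i < k \<and> g \<in> S i)"
    have "\<exists>i. i < k \<and> g \<in> S i" using S(2) g by auto
    then have "i < k \<and> g \<in> S i" unfolding i_def by (rule LeastI_ex)
    then have i: "i < k" "g \<in> S i" by simp_all
    have before: "g \<notin> S j" if "j < i" for j
      using not_less_Least[OF that[unfolded i_def]] that i(1) by simp
    have "eventually (\<lambda>n. layer (pre g n) = i) sequentially"
      unfolding layer_def
    proof (rule eventually_Least_eq
        [where P = "\<lambda>n i. k \<le> Suc i \<or> (\<forall>l\<le>length (pre g n). P i (take l (pre g n)))"])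
      have "\<forall>n. P i (pre g n)" using P(2) i by auto
      then show "eventually (\<lambda>n. k \<le> Suc i \<or> (\<forall>l\<le>length (pre g n). P i (take l (pre g n)))) sequentially"
        by simp
      fix j assume "j < i"
      then obtain m where m: "\<not> P j (pre g m)" using before[of j] P(2) i(1) by auto
      have "\<not> k \<le> Suc j" using \<open>j < i\<close> i(1) by simp
      with eventually_violated[of "P j", OF m]
      show "eventually (\<lambda>n. \<not> (k \<le> Suc j \<or> (\<forall>l\<le>length (pre g n). P j (take l (pre g n))))) sequentially"
        by (elim eventually_mono) blast
    qed
    then have "eventually (\<lambda>n. e (layer (pre g n)) = e i) sequentially" by (rule eventually_mono) simp
    then have lim: "(\<lambda>n. e (layer (pre g n))) \<longlonglongrightarrow> e i" by (rule tendsto_eventually)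
    \<comment> \<open>The least cumulative set that contains \<open>g\<close> identifies its
      layer.\<close>
    have "g \<in> S i - (case i of 0 \<Rightarrow> {} | Suc j \<Rightarrow> S j)"
      using i(2) before[of "i - 1"] by (cases i) simp_all
    then have "g \<in> R i" using R i(1) g by simp
    then have Phi: "Phi (e i) g = \<Gamma> g" using e(2) i(1) by simp
    \<comment> \<open>A layer that survives the tests on a longer prefix has survived them on every
      shorter one, so guesses never decrease.\<close>
    have mono: "layer (pre g n) \<le> layer (pre g (Suc n))" for n
    proof -
      have "k \<le> Suc (layer (pre g (Suc n))) \<or>
        (\<forall>l\<le>length (pre g (Suc n)). P (layer (pre g (Suc n))) (take l (pre g (Suc n))))"
        using LeastI_ex[OF ex[of "pre g (Suc n)"]] unfolding layer_def[symmetric] .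
      then have "k \<le> Suc (layer (pre g (Suc n))) \<or>
        (\<forall>l\<le>length (pre g n). P (layer (pre g (Suc n))) (take l (pre g n)))" by auto
      then show ?thesis unfolding layer_def[of "pre g n"] by (rule Least_le)
    qed
    have bound: "layer (pre g n) \<le> k - 1" for n unfolding layer_def by (intro Least_le disjI1) simp
    have "mcl (\<lambda>\<sigma>. e (layer \<sigma>)) g \<subseteq> {n. layer (pre g (Suc n)) \<noteq> layer (pre g n)}"
      by (auto simp: mcl_def)
    then have "ecard (mcl (\<lambda>\<sigma>. e (layer \<sigma>)) g) \<le> ecard {n. layer (pre g (Suc n)) \<noteq> layer (pre g n)}"
      by (rule ecard_mono)
    also have "\<dots> \<le> enat (k - 1)"
      using card_changes_mono_bounded[of "\<lambda>n. layer (pre g n)", OF mono bound] by (simp add: ecard_def)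
    also have "\<dots> < enat k" using i(1) by simp
    finally show ?thesis unfolding learns_def using lim Phi by auto
  qed
  then have "\<forall>g \<in> dom \<Gamma>. learns (learner d) (enat k) \<infinity> \<Gamma> g" using d by blast
  then show "\<Gamma> \<in> CT 1 (enat k) \<infinity>" unfolding CT_1_iff by (rule exI)
qed


subsection \<open>Several learners\<close>

lemma CT_constant_iff:
  "\<Gamma> \<in> CT (enat k) 1 \<infinity> \<longleftrightarrow> (\<exists>c. \<forall>g \<in> dom \<Gamma>. \<exists>i<k. Phi (c i) g = \<Gamma> g)"
proof
  assume "\<Gamma> \<in> CT (enat k) 1 \<infinity>"
  then obtain E where E: "\<forall>g \<in> dom \<Gamma>. \<exists>i<k. learns (learner (E i)) 1 \<infinity> \<Gamma> g"
    unfolding CT_enat_iff by blast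
  have "\<forall>g \<in> dom \<Gamma>. \<exists>i<k. Phi (learner (E i) []) g = \<Gamma> g"
    using E learns_one[of _ \<infinity> \<Gamma>] by blast
  then show "\<exists>c. \<forall>g \<in> dom \<Gamma>. \<exists>i<k. Phi (c i) g = \<Gamma> g"
    by (rule exI[of _ "\<lambda>i. learner (E i) []"])
next
  assume "\<exists>c. \<forall>g \<in> dom \<Gamma>. \<exists>i<k. Phi (c i) g = \<Gamma> g"
  then obtain c where c: "\<forall>g \<in> dom \<Gamma>. \<exists>i<k. Phi (c i) g = \<Gamma> g" by blast
  have "\<forall>i. \<exists>e. \<forall>\<Gamma> g. Phi (c i) g = \<Gamma> g \<longrightarrow> learns (learner e) 1 \<infinity> \<Gamma> g"
    using constant_learner by blast
  then obtain E where E: "\<forall>i \<Gamma> g. Phi (c i) g = \<Gamma> g \<longrightarrow> learns (learner (E i)) 1 \<infinity> \<Gamma> g"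
    by (rule choice[THEN exE])
  have "\<forall>g \<in> dom \<Gamma>. \<exists>i<k. learns (learner (E i)) 1 \<infinity> \<Gamma> g" using c E by blast
  then show "\<Gamma> \<in> CT (enat k) 1 \<infinity>" unfolding CT_enat_iff by (rule exI[of _ E])
qed

lemma CT_infinity_constant_iff: "\<Gamma> \<in> CT \<infinity> 1 \<infinity> \<longleftrightarrow> (\<forall>g \<in> dom \<Gamma>. \<exists>p. Phi p g = \<Gamma> g)"
  unfolding CT_infinity_iff using learns_one[of _ \<infinity> \<Gamma>] constant_learner by blast

text \<open>Without a definability requirement one correct piece can be chosen for each
  \<open>g\<close>, and the fibres of this choice have every shape. Only the correctness of some
  index for each \<open>g\<close> remains.\<close>

lemma dec_UNIV_iff:
  "\<Gamma> \<in> dec x X UNIV \<longleftrightarrow> (\<exists>c. computable c \<and> (\<forall>g \<in> dom \<Gamma>. \<exists>i \<in> segment X. Phi (c i) g = \<Gamma> g))"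
proof
  assume "\<Gamma> \<in> dec x X UNIV"
  then obtain R c where R: "decomposition x UNIV (segment X) (dom \<Gamma>) R"
    and c: "computable c" "\<forall>i \<in> segment X. \<forall>g \<in> R i. \<Gamma> g = Phi (c i) g"
    unfolding dec_def piecewise_def by blast
  have "\<forall>g \<in> dom \<Gamma>. \<exists>i \<in> segment X. Phi (c i) g = \<Gamma> g"
  proof
    fix g assume "g \<in> dom \<Gamma>"
    then obtain i where "i \<in> segment X" "g \<in> R i" using decomposition_cover[OF R] by blast
    then show "\<exists>i \<in> segment X. Phi (c i) g = \<Gamma> g" using c(2) by auto
  qed
  then show "\<exists>c. computable c \<and> (\<forall>g \<in> dom \<Gamma>. \<exists>i \<in> segment X. Phi (c i) g = \<Gamma> g)" using c(1) by blast
next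
  assume "\<exists>c. computable c \<and> (\<forall>g \<in> dom \<Gamma>. \<exists>i \<in> segment X. Phi (c i) g = \<Gamma> g)"
  then obtain c where c: "computable c" "\<forall>g \<in> dom \<Gamma>. \<exists>i \<in> segment X. Phi (c i) g = \<Gamma> g" by blast
  define L where "L g = (SOME i. i \<in> segment X \<and> Phi (c i) g = \<Gamma> g)" for g
  have L: "L g \<in> segment X \<and> Phi (c (L g)) g = \<Gamma> g" if "g \<in> dom \<Gamma>" for g
    unfolding L_def by (rule someI_ex) (use c(2) that in blast)
  have "decomposition x UNIV (segment X) (dom \<Gamma>) (\<lambda>i. {g \<in> dom \<Gamma>. L g = i})"
    using L by (intro decomposition_UNIV) blast
  moreover have "piecewise (segment X) (\<lambda>i. {g \<in> dom \<Gamma>. L g = i}) \<Gamma>"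
    unfolding piecewise_def
  proof (intro exI[of _ c] conjI ballI)
    show "\<Gamma> g = Phi (c i) g" if "g \<in> {g \<in> dom \<Gamma>. L g = i}" for g i using L[of g] that by simp
  qed (rule c(1))
  ultimately show "\<Gamma> \<in> dec x X UNIV" unfolding dec_def by blast
qed

lemma CT_constant_eq_dec: "CT (enat k) 1 \<infinity> = dec x (enat k) UNIV"
proof (rule set_eqI)
  fix \<Gamma>
  show "\<Gamma> \<in> CT (enat k) 1 \<infinity> \<longleftrightarrow> \<Gamma> \<in> dec x (enat k) UNIV"
    unfolding CT_constant_iff dec_UNIV_iff
  proof
    assume "\<exists>c. \<forall>g \<in> dom \<Gamma>. \<exists>i<k. Phi (c i) g = \<Gamma> g"
    then obtain c where c: "\<forall>g \<in> dom \<Gamma>. \<exists>i<k. Phi (c i) g = \<Gamma> g" by blast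
    obtain d where d: "computable d" "\<forall>i<k. d i = c i" using finite_function_computable by blast
    have "\<forall>g \<in> dom \<Gamma>. \<exists>i \<in> segment (enat k). Phi (d i) g = \<Gamma> g"
    proof
      fix g assume "g \<in> dom \<Gamma>"
      then obtain i where "i < k" "Phi (c i) g = \<Gamma> g" using c by blast
      then show "\<exists>i \<in> segment (enat k). Phi (d i) g = \<Gamma> g" using d(2) by (intro bexI[of _ i]) simp_all
    qed
    then show "\<exists>c. computable c \<and> (\<forall>g \<in> dom \<Gamma>. \<exists>i \<in> segment (enat k). Phi (c i) g = \<Gamma> g)"
      using d(1) by blast
  qed (auto simp: lessThan_iff Bex_def)
qed

lemma CT_infinity_constant_eq_dec: "CT \<infinity> 1 \<infinity> = dec x \<infinity> UNIV"
proof (rule set_eqI)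
  fix \<Gamma>
  \<comment> \<open>With infinitely many pieces the program itself can be the number of the
    piece.\<close>
  have "computable (\<lambda>i. i)" by (intro effective_computable effective_intros)
  then show "\<Gamma> \<in> CT \<infinity> 1 \<infinity> \<longleftrightarrow> \<Gamma> \<in> dec x \<infinity> UNIV"
    unfolding CT_infinity_constant_iff dec_UNIV_iff segment_simps by blast
qed

text \<open>Each \<open>g\<close> is assigned to one of its successful learners; conversely, a
  learner is taken for each piece. Stated for \<open>CT 1 \<infinity> \<infinity>\<close>, it covers
  all the inner decomposition classes at once, as they coincide with this class.\<close>

lemma CT_eq_dec_class: "CT (enat k) \<infinity> \<infinity> = dec_class y k (CT 1 \<infinity> \<infinity>)"
proof (rule set_eqI)
  fix \<Gamma>
  show "\<Gamma> \<in> CT (enat k) \<infinity> \<infinity> \<longleftrightarrow> \<Gamma> \<in> dec_class y k (CT 1 \<infinity> \<infinity>)"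
  proof
    assume "\<Gamma> \<in> CT (enat k) \<infinity> \<infinity>"
    then obtain E where E: "\<forall>g \<in> dom \<Gamma>. \<exists>i<k. learns (learner (E i)) \<infinity> \<infinity> \<Gamma> g"
      unfolding CT_enat_iff by blast
    define L where "L g = (SOME i. i < k \<and> learns (learner (E i)) \<infinity> \<infinity> \<Gamma> g)" for g
    have L: "L g < k \<and> learns (learner (E (L g))) \<infinity> \<infinity> \<Gamma> g" if "g \<in> dom \<Gamma>" for g
      unfolding L_def by (rule someI_ex) (use E that in blast)
    let ?R = "\<lambda>i. {g \<in> dom \<Gamma>. L g = i}"
    have "decomposition y UNIV (segment (enat k)) (dom \<Gamma>) ?R"
      using L by (intro decomposition_UNIV) simp
    moreover have "\<Gamma> |` ?R i \<in> CT 1 \<infinity> \<infinity>" for i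
      unfolding CT_1_iff
    proof (intro exI[of _ "E i"] ballI)
      fix g assume "g \<in> dom (\<Gamma> |` ?R i)"
      then have g: "g \<in> dom \<Gamma>" "L g = i" by (auto simp: restrict_map_def split: if_splits)
      then have "(\<Gamma> |` ?R i) g = \<Gamma> g" by (auto simp: restrict_map_def)
      then show "learns (learner (E i)) \<infinity> \<infinity> (\<Gamma> |` ?R i) g" using L[OF g(1)] g(2) unfolding learns_def by simp
    qed
    ultimately show "\<Gamma> \<in> dec_class y k (CT 1 \<infinity> \<infinity>)"
      unfolding dec_class_def mem_Collect_eq segment_simps by (intro exI[of _ ?R] conjI allI impI)
  next
    assume "\<Gamma> \<in> dec_class y k (CT 1 \<infinity> \<infinity>)"
    then obtain R where "decomposition y UNIV {..<k} (dom \<Gamma>) R" and R: "\<forall>i<k. \<Gamma> |` R i \<in> CT 1 \<infinity> \<infinity>"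
      unfolding dec_class_def by blast
    then have cover: "(\<Union>i<k. R i) = dom \<Gamma>"
      using decomposition_cover[of y UNIV "enat k" "dom \<Gamma>" R] by simp
    have "\<forall>i. \<exists>e. i < k \<longrightarrow> (\<forall>g \<in> dom (\<Gamma> |` R i). learns (learner e) \<infinity> \<infinity> (\<Gamma> |` R i) g)"
      using R unfolding CT_1_iff by blast
    then obtain E where E: "\<forall>i. i < k \<longrightarrow> (\<forall>g \<in> dom (\<Gamma> |` R i). learns (learner (E i)) \<infinity> \<infinity> (\<Gamma> |` R i) g)"
      by (rule choice[THEN exE])
    have "\<forall>g \<in> dom \<Gamma>. \<exists>i<k. learns (learner (E i)) \<infinity> \<infinity> \<Gamma> g"
    proof
      fix g assume g: "g \<in> dom \<Gamma>"
      then obtain i where i: "i < k" "g \<in> R i" using cover by blast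
      have "g \<in> dom (\<Gamma> |` R i)" "(\<Gamma> |` R i) g = \<Gamma> g" using g i(2) by simp_all
      then have "learns (learner (E i)) \<infinity> \<infinity> \<Gamma> g" using E i(1) unfolding learns_def by metis
      then show "\<exists>i<k. learns (learner (E i)) \<infinity> \<infinity> \<Gamma> g" using i(1) by blast
    qed
    then show "\<Gamma> \<in> CT (enat k) \<infinity> \<infinity>" unfolding CT_enat_iff by (rule exI[of _ E])
  qed
qed

text \<open>One circle of inclusions, from \<open>CT 1 \<infinity> X\<close> through the
  decompositions relative to the domain to the Sigma-0-2 covers and back, holds for every
  \<open>X\<close>. For infinite \<open>X\<close> the settling stage gives Pi-0-1 pieces, which are
  Delta-0-2 outright; thus the plain Delta-0-2 classes join as equalities there, while for finite
  \<open>k\<close> they enter by inclusion.\<close>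

theorem theorem2p14:
  fixes k :: nat
  shows
   "(CT 1 (enat k) \<infinity> = dec Layer (enat k) Pi01) \<and>
    (\<forall>x. CT 1 \<infinity> (enat k) = dec_relDelta02 x (enat k) \<and>
         dec x (enat k) Delta02 \<subseteq> CT 1 \<infinity> (enat k) \<and>
         CT 1 \<infinity> (enat k) = dec Cover (enat k) Sigma02) \<and>
    (\<forall>x. CT 1 \<infinity> \<infinity> = dec x \<infinity> Pi01 \<and>
         CT 1 \<infinity> \<infinity> = dec x \<infinity> Delta02 \<and>
         CT 1 \<infinity> \<infinity> = dec Cover \<infinity> Sigma02) \<and>
    (\<forall>x. CT (enat k) 1 \<infinity> = dec x (enat k) UNIV) \<and>
    (\<forall>x y. CT (enat k) \<infinity> \<infinity> = dec_class y k (dec x \<infinity> Pi01) \<and>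
           CT (enat k) \<infinity> \<infinity> = dec_class y k (dec x \<infinity> Delta02) \<and>
           CT (enat k) \<infinity> \<infinity> = dec_class y k (dec Cover \<infinity> Sigma02)) \<and>
    (\<forall>x. CT \<infinity> 1 \<infinity> = dec x \<infinity> UNIV)"
proof -
  have cover: "CT 1 \<infinity> X = dec Cover X Sigma02" for X
    using CT_subset_dec_relDelta02[of X Cover] dec_relDelta02_subset[of Cover X]
      covers_Sigma02_subset_CT[of X] by (intro equalityI) (blast intro: subset_trans)+
  have rel: "CT 1 \<infinity> X = dec_relDelta02 x X" for x X
    using CT_subset_dec_relDelta02[of X x] dec_relDelta02_subset[of x X] cover[of X] by simp
  have Delta: "dec x X Delta02 \<subseteq> CT 1 \<infinity> X" for x X
    using dec_Delta02_subset[of x X] rel[of X x] by simp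
  have Pi: "dec x \<infinity> Pi01 \<subseteq> dec x \<infinity> Delta02" for x by (rule dec_mono) (rule Pi01_subset_Delta02)
  have Pi_eq: "CT 1 \<infinity> \<infinity> = dec x \<infinity> Pi01" for x
    using CT_subset_dec_Pi01 subset_trans[OF Pi Delta] by (rule equalityI)
  have Delta_eq: "CT 1 \<infinity> \<infinity> = dec x \<infinity> Delta02" for x
    using subset_trans[OF CT_subset_dec_Pi01 Pi] Delta by (rule equalityI)
  have layers: "CT 1 (enat k) \<infinity> = dec Layer (enat k) Pi01"
    using CT_subset_layers_Pi01 layers_Pi01_subset_CT by (rule equalityI)
  show ?thesis
    using layers rel Delta cover Pi_eq Delta_eq CT_constant_eq_dec CT_infinity_constant_eq_dec
    unfolding Pi_eq[symmetric] Delta_eq[symmetric] cover[symmetric] CT_eq_dec_class[symmetric]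
    by (intro conjI allI refl)
qed

end
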